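(* Let $N\ge 1$, $0<\rho\le 1$ and $M>0$. For $1\le m\le N$ let $K_m:\mathbb{R}\to\mathbb{R}$ be kernels with $K_m\in W^{1,1}(\mathbb{R})$, none of which vanishes identically on $\mathbb{R}$; let $u_{0,m}:\mathbb{R}\to\mathbb{R}$, $u_{0,m}\in H^1(\mathbb{R})$, with $u_{0,m}$ nontrivial for some $1\le m\le N$, and put $u_0=(u_{0,1},\dots,u_{0,N})^T$; let $T_m:H^1(\mathbb{R})\to H^1(\mathbb{R})$ be bounded linear operators with norms $0<\|T_m\|<\infty$. For $j=1,2$ let $g_j=(g_{j,1},\dots,g_{j,N})$ with $g_{j,m}:\mathbb{R}^N\to\mathbb{R}$, $g_{j,m}(0)=0$ for $1\le m\le N$, and suppose that $g_j|_I\in D_M$ and $g_j$ does not vanish identically in the ball $I$. Suppose that $$c_aM\left(\|u_0\|_{H^1(\mathbb{R},\mathbb{R}^N)}+1\right)^2Q\le\frac{\rho}{2}.$$ For $j=1,2$ let $u_{p,j}$ be the unique fixed point in $B_\rho$ of the map $\tau_{g_j}:B_\rho\to B_\rho$, and let $$u_j(x)=u_0(x)+u_{p,j}(x)$$ be the resulting solution of the system $$u_m(x)=u_{0,m}(x)+[T_mu_m](x)\int_{-\infty}^{\infty}K_m(x-y)\,g_m(u(y))\,dy,\qquad x\in\mathbb{R},\ 1\le m\le N,$$ with $g=g_j$. Then $$\|u_1-u_2\|_{H^1(\mathbb{R},\mathbb{R}^N)}\le\frac{\sigma}{2M(1-\sigma)}\left(\|u_0\|_{H^1(\mathbb{R},\mathbb{R}^N)}+1\right)\|g_1-g_2\|_{C^1(I,\mathbb{R}^N)},$$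 where $\sigma:=2c_aQM\left(\|u_0\|_{H^1(\mathbb{R},\mathbb{R}^N)}+1\right)$.
   Context: All functions are real-valued. $H^1(\mathbb{R})=\{\phi:\mathbb{R}\to\mathbb{R}\mid \phi\in L^2(\mathbb{R}),\ d\phi/dx\in L^2(\mathbb{R})\}$ with norm $\|\phi\|_{H^1(\mathbb{R})}^2=\|\phi\|_{L^2(\mathbb{R})}^2+\|d\phi/dx\|_{L^2(\mathbb{R})}^2$. For $u=(u_1,\dots,u_N)^T$, $\|u\|_{H^1(\mathbb{R},\mathbb{R}^N)}^2=\sum_{m=1}^N\|u_m\|_{L^2(\mathbb{R})}^2+\sum_{m=1}^N\|du_m/dx\|_{L^2(\mathbb{R})}^2$. Also $\|K\|_{W^{1,1}(\mathbb{R})}=\|K\|_{L^1(\mathbb{R})}+\|dK/dx\|_{L^1(\mathbb{R})}$. $c_a>0$ is a constant for the algebra property of $H^1(\mathbb{R})$: for all $\phi_1,\phi_2\in H^1(\mathbb{R})$ one has $\phi_1\phi_2\in H^1(\mathbb{R})$ and $\|\phi_1\phi_2\|_{H^1(\mathbb{R})}\le c_a\|\phi_1\|_{H^1(\mathbb{R})}\|\phi_2\|_{H^1(\mathbb{R})}$. $Q:=\sqrt{\sum_{m=1}^N\|T_m\|^2\|K_m\|_{W^{1,1}(\mathbb{R})}^2}$, where $\|T_m\|$ is the operator norm on $H^1(\mathbb{R})$. $B_\rho:=\{u\in H^1(\mathbb{R},\mathbb{R}^N)\mid \|u\|_{H^1(\mathbb{R},\mathbb{R}^N)}\le\rho\}$.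 $I:=\{z\in\mathbb{R}^N\mid |z|_{\mathbb{R}^N}\le\frac{1}{\sqrt2}(\|u_0\|_{H^1(\mathbb{R},\mathbb{R}^N)}+1)\}$, a closed ball in the Euclidean norm. $D_M:=\{g=(g_1,\dots,g_N)\in C^1(I,\mathbb{R}^N)\mid \|g\|_{C^1(I,\mathbb{R}^N)}\le M\}$, where $\|g\|_{C^1(I,\mathbb{R}^N)}:=\sum_{m=1}^N\|g_m\|_{C^1(I)}$, $\|g_m\|_{C^1(I)}:=\|g_m\|_{C(I)}+\sum_{n=1}^N\left\|\frac{\partial g_m}{\partial z_n}\right\|_{C(I)}$, and $\|\phi\|_{C(I)}:=\max_{z\in I}|\phi(z)|$. For $g=(g_1,\dots,g_N)$ the map $\tau_g$ is defined by $u=\tau_g v$, where for $1\le m\le N$ $$u_m(x)=[T_m(u_{0,m}+v_m)](x)\int_{-\infty}^{\infty}K_m(x-y)\,g_m(u_0(y)+v(y))\,dy,\qquad x\in\mathbb{R}.$$ Under the stated hypotheses, for $g=g_1$ and $g=g_2$ this map sends $B_\rho$ into $B_\rho$ and has a unique fixed point there. Elements of $H^1(\mathbb{R})$ are identified with their continuous representatives. *)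

theory Defs
  imports "HOL-Analysis.Analysis"
begin

section \<open>Weak derivatives and Sobolev spaces on the real line\<close>

definition test_function :: "(real \<Rightarrow> real) \<Rightarrow> bool" where
  "test_function \<eta> \<longleftrightarrow>
     (\<forall>k. (deriv ^^ k) \<eta> differentiable_on UNIV) \<and> compact (closure {x. \<eta> x \<noteq> 0})"

definition locally_integrable :: "(real \<Rightarrow> real) \<Rightarrow> bool" where
  "locally_integrable f \<longleftrightarrow> (\<forall>a b. set_integrable lebesgue {a..b} f)"

definition has_weak_deriv :: "(real \<Rightarrow> real) \<Rightarrow> (real \<Rightarrow> real) \<Rightarrow> bool" where
  "has_weak_deriv f f' \<longleftrightarrow> locally_integrable f \<and> locally_integrable f' \<and>
     (\<forall>\<eta>. test_function \<eta> \<longrightarrow>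
        (LINT x|lebesgue. f x * deriv \<eta> x) = - (LINT x|lebesgue. f' x * \<eta> x))"

text \<open>A weak derivative is determined only up to a null set; the choice made here is
  used exclusively inside integrals.\<close>

definition weak_deriv :: "(real \<Rightarrow> real) \<Rightarrow> real \<Rightarrow> real" where
  "weak_deriv f = (SOME f'. has_weak_deriv f f')"

definition L2_space :: "(real \<Rightarrow> real) set" where
  "L2_space = {f. f \<in> borel_measurable lebesgue \<and> integrable lebesgue (\<lambda>x. (f x)\<^sup>2)}"

definition L2_norm :: "(real \<Rightarrow> real) \<Rightarrow> real" where
  "L2_norm f = sqrt (LINT x|lebesgue. (f x)\<^sup>2)"

definition L1_norm :: "(real \<Rightarrow> real) \<Rightarrow> real" where
  "L1_norm f = (LINT x|lebesgue. \<bar>f x\<bar>)"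

text \<open>Elements of \<open>H\<^sup>1\<close> are represented by their continuous representatives, so that equality
  of elements is equality of functions.\<close>

definition H1_space :: "(real \<Rightarrow> real) set" where
  "H1_space = {f. continuous_on UNIV f \<and> f \<in> L2_space \<and>
                  (\<exists>f'. has_weak_deriv f f' \<and> f' \<in> L2_space)}"

definition H1_norm :: "(real \<Rightarrow> real) \<Rightarrow> real" where
  "H1_norm f = sqrt ((L2_norm f)\<^sup>2 + (L2_norm (weak_deriv f))\<^sup>2)"

text \<open>No representative is singled out in \<open>W\<^sup>1\<^sup>,\<^sup>1\<close>: its members are arbitrary Lebesgue measurable
  functions, to be understood up to equality almost everywhere.\<close>

definition W11_space :: "(real \<Rightarrow> real) set" where
  "W11_space = {f. integrable lebesgue f \<and>
                   (\<exists>f'. has_weak_deriv f f' \<and> integrable lebesgue f')}"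

definition W11_norm :: "(real \<Rightarrow> real) \<Rightarrow> real" where
  "W11_norm f = L1_norm f + L1_norm (weak_deriv f)"

definition H1vec_space :: "(real \<Rightarrow> real ^ 'n) set" where
  "H1vec_space = {u. \<forall>m. (\<lambda>x. u x $ m) \<in> H1_space}"

definition H1vec_norm :: "(real \<Rightarrow> real ^ 'n) \<Rightarrow> real" where
  "H1vec_norm u = sqrt ((\<Sum>m\<in>UNIV. (L2_norm (\<lambda>x. u x $ m))\<^sup>2)
                      + (\<Sum>m\<in>UNIV. (L2_norm (weak_deriv (\<lambda>x. u x $ m)))\<^sup>2))"

definition H1vec_ball :: "real \<Rightarrow> (real \<Rightarrow> real ^ 'n) set" where
  "H1vec_ball \<rho> = {u \<in> H1vec_space. H1vec_norm u \<le> \<rho>}"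

definition H1_algebra_constant :: "real \<Rightarrow> bool" where
  "H1_algebra_constant c \<longleftrightarrow> c > 0 \<and>
     (\<forall>f\<in>H1_space. \<forall>h\<in>H1_space.
        (\<lambda>x. f x * h x) \<in> H1_space \<and> H1_norm (\<lambda>x. f x * h x) \<le> c * H1_norm f * H1_norm h)"


section \<open>Bounded linear operators on the Sobolev space\<close>

text \<open>Operators are functions on all of \<^typ>\<open>real \<Rightarrow> real\<close>; only their values on
  \<^const>\<open>H1_space\<close> matter.\<close>

definition bounded_linear_H1 :: "((real \<Rightarrow> real) \<Rightarrow> (real \<Rightarrow> real)) \<Rightarrow> bool" where
  "bounded_linear_H1 T \<longleftrightarrow>
     (\<forall>f\<in>H1_space. T f \<in> H1_space) \<and>
     (\<forall>f\<in>H1_space. \<forall>h\<in>H1_space. T (\<lambda>x. f x + h x) = (\<lambda>x. T f x + T h x)) \<and>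
     (\<forall>c. \<forall>f\<in>H1_space. T (\<lambda>x. c * f x) = (\<lambda>x. c * T f x)) \<and>
     (\<exists>C. \<forall>f\<in>H1_space. H1_norm (T f) \<le> C * H1_norm f)"

text \<open>As in \<^const>\<open>onorm\<close>, the zero function contributes the quotient \<open>0 / 0 = 0\<close>.\<close>

definition onorm_H1 :: "((real \<Rightarrow> real) \<Rightarrow> (real \<Rightarrow> real)) \<Rightarrow> real" where
  "onorm_H1 T = (SUP f\<in>H1_space. H1_norm (T f) / H1_norm f)"


section \<open>Continuously differentiable functions on a closed ball\<close>

text \<open>Differentiability at a point of \<open>I\<close>, including boundary points, is relative to \<open>I\<close>. For a closed
  ball of positive radius the relative derivative is unique, so \<open>partial_within I h n z\<close> is the usual
  partial derivative in the interior and its continuous extension on the boundary.\<close>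

definition partial_within ::
    "(real ^ 'n) set \<Rightarrow> (real ^ 'n \<Rightarrow> real) \<Rightarrow> 'n \<Rightarrow> real ^ 'n \<Rightarrow> real" where
  "partial_within I h n z = frechet_derivative h (at z within I) (axis n 1)"

definition C1_on :: "(real ^ 'n) set \<Rightarrow> (real ^ 'n \<Rightarrow> real) \<Rightarrow> bool" where
  "C1_on I h \<longleftrightarrow> h differentiable_on I \<and> (\<forall>n. continuous_on I (partial_within I h n))"

definition C_norm :: "(real ^ 'n) set \<Rightarrow> (real ^ 'n \<Rightarrow> real) \<Rightarrow> real" where
  "C_norm I h = (SUP z\<in>I. \<bar>h z\<bar>)"

definition C1_norm :: "(real ^ 'n) set \<Rightarrow> (real ^ 'n \<Rightarrow> real) \<Rightarrow> real" where
  "C1_norm I h = C_norm I h + (\<Sum>n\<in>UNIV. C_norm I (partial_within I h n))"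

definition C1vec_norm :: "(real ^ 'n) set \<Rightarrow> (real ^ 'n \<Rightarrow> real ^ 'n) \<Rightarrow> real" where
  "C1vec_norm I g = (\<Sum>m\<in>UNIV. C1_norm I (\<lambda>z. g z $ m))"

definition C1vec_ball :: "(real ^ 'n) set \<Rightarrow> real \<Rightarrow> (real ^ 'n \<Rightarrow> real ^ 'n) set" where
  "C1vec_ball I M = {g. (\<forall>m. C1_on I (\<lambda>z. g z $ m)) \<and> C1vec_norm I g \<le> M}"


section \<open>The integral system\<close>

definition range_ball :: "(real \<Rightarrow> real ^ 'n) \<Rightarrow> (real ^ 'n) set" where
  "range_ball u0 = cball 0 (1 / sqrt 2 * (H1vec_norm u0 + 1))"

definition Q_const ::
    "('n \<Rightarrow> (real \<Rightarrow> real) \<Rightarrow> (real \<Rightarrow> real)) \<Rightarrow> ('n :: finite \<Rightarrow> real \<Rightarrow> real) \<Rightarrow> real" where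
  "Q_const T K = sqrt (\<Sum>m\<in>UNIV. (onorm_H1 (T m))\<^sup>2 * (W11_norm (K m))\<^sup>2)"

definition tau ::
    "('n \<Rightarrow> (real \<Rightarrow> real) \<Rightarrow> (real \<Rightarrow> real)) \<Rightarrow> ('n \<Rightarrow> real \<Rightarrow> real) \<Rightarrow> (real \<Rightarrow> real ^ 'n) \<Rightarrow>
     (real ^ 'n \<Rightarrow> real ^ 'n) \<Rightarrow> (real \<Rightarrow> real ^ 'n) \<Rightarrow> (real \<Rightarrow> real ^ 'n)" where
  "tau T K u0 g v =
     (\<lambda>x. \<chi> m. T m (\<lambda>y. u0 y $ m + v y $ m) x *
               (LINT y|lebesgue. K m (x - y) * g (u0 y + v y) $ m))"

lemma fixed_point_tau_solves_system:
  assumes "tau T K u0 g v = v" and "u = (\<lambda>x. u0 x + v x)"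
  shows "u x $ m = u0 x $ m + T m (\<lambda>y. u y $ m) x * (LINT y|lebesgue. K m (x - y) * g (u y) $ m)"
proof -
  have "v x $ m = tau T K u0 g v x $ m"
    using assms(1) by simp
  then show ?thesis
    by (simp add: assms(2) tau_def)
qed

end

theory Submission
  imports Defs "HOL-Computational_Algebra.Polynomial"
begin

text \<open>
  Write \<open>R = \<parallel>u0\<parallel> + 1\<close> and \<open>w = u1 - u2\<close>. Subtracting the two fixed point equations and splitting the
  difference of products gives, for each component,
  \<open>w\<^sub>m = T\<^sub>m w\<^sub>m \<cdot> (K\<^sub>m * g1\<^sub>m(u1)) + T\<^sub>m u2\<^sub>m \<cdot> (K\<^sub>m * (g1\<^sub>m(u1) - g2\<^sub>m(u2)))\<close>.
  The algebra property and the operator norm reduce the estimate to the \<open>H\<^sup>1\<close> norm of the two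
  convolutions, and \<open>\<parallel>K * G\<parallel> \<le> \<parallel>K\<parallel> \<parallel>G\<parallel>\<close> with \<open>K\<close> in \<open>W\<^sup>1\<^sup>,\<^sup>1\<close> and \<open>G\<close> in \<open>L\<^sup>2\<close> (lemma \<open>conv_H1\<close>) reduces
  it further to \<open>L\<^sup>2\<close> norms of \<open>g1\<^sub>m(u1)\<close> and \<open>g1\<^sub>m(u1) - g2\<^sub>m(u2)\<close>.

  These are bounded by Lipschitz estimates. Both solutions have norm at most \<open>R\<close>, so by the Sobolev
  inequality with constant \<open>1 / sqrt 2\<close> (lemma \<open>H1vec_Sobolev\<close>) they take values in the ball \<open>I\<close>. There \<open>g1\<^sub>m\<close> is
  Lipschitz with constant \<open>M\<close>, and \<open>g1\<^sub>m - g2\<^sub>m\<close> is Lipschitz with constant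
  \<open>D = \<parallel>g1 - g2\<parallel>\<close> and vanishes at the origin. Hence the two \<open>L\<^sup>2\<close> norms are at most \<open>M R\<close> and
  \<open>M \<parallel>w\<parallel> + D R\<close>, and the Euclidean norm over the components is
  \<open>\<parallel>w\<parallel> \<le> c\<^sub>a Q (2 M R \<parallel>w\<parallel> + R\<^sup>2 D) = \<sigma> \<parallel>w\<parallel> + \<sigma> / (2 M) R D\<close>.
  Since \<open>\<sigma> R \<le> \<rho> \<le> 1 < R\<close>, one has \<open>\<sigma> < 1\<close> and can solve for \<open>\<parallel>w\<parallel>\<close>.

  The norms are defined through weak derivatives, so most of the work is to show that these behave
  as expected: uniqueness, linearity, the fundamental theorem of calculus for a
  continuous representative, and differentiation of a convolution on its kernel. The first and the third
  come from one family of test functions that approximate the indicator of an interval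
  (lemma \<open>interval_test_functions\<close>).
\<close>

section \<open>Smooth functions of compact support\<close>

text \<open>The factor \<open>exp (- 1 / (x (1 - x)))\<close> is flat at both endpoints. Polynomials over powers of \<open>x (1 - x)\<close>
  are allowed in front of it because this makes the family closed under differentiation, so that
  smoothness needs only first derivatives.\<close>

definition bump :: "real poly \<Rightarrow> nat \<Rightarrow> real \<Rightarrow> real" where
  "bump p k x = (if 0 < x \<and> x < 1
     then poly p x / (x * (1 - x)) ^ k * exp (- 1 / (x * (1 - x))) else 0)"

lemma exp_minus_inverse_le_power:
  fixes q :: real
  assumes "0 < q"
  shows "exp (- 1 / q) \<le> fact n * q ^ n"
proof -
  have "(1/q) ^ n / fact n \<le> exp (1/q)"
  proof -
    have "(\<Sum>i\<in>{n}. (1/q) ^ i /\<^sub>R fact i) \<le> (\<Sum>i. (1/q) ^ i /\<^sub>R fact i)"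
      using assms by (intro sum_le_suminf summable_exp_generic) auto
    thus ?thesis by (simp add: exp_def divide_inverse mult.commute)
  qed
  hence "1 / exp (1/q) \<le> 1 / ((1/q) ^ n / fact n)"
    using assms by (intro divide_left_mono) auto
  thus ?thesis by (simp add: exp_minus inverse_eq_divide power_divide mult.commute)
qed

text \<open>The square makes the function differentiable with derivative zero at the two endpoints.\<close>

lemma bump_le_square:
  obtains C where "C \<ge> 0" "\<And>x. \<bar>bump p k x\<bar> \<le> C * (x * (1 - x))\<^sup>2"
proof -
  have "compact (poly p ` {0..1})"
    by (intro compact_continuous_image continuous_intros) auto
  then obtain B where B: "\<And>x. x \<in> {0..1} \<Longrightarrow> \<bar>poly p x\<bar> \<le> B"
    by (metis compact_imp_bounded bounded_iff image_eqI real_norm_def)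
  have B0: "0 \<le> B" using B[of 0] by auto
  show ?thesis
  proof (rule that[of "B * fact (k + 2)"])
    show "0 \<le> B * fact (k + 2)" using B0 by simp
    fix x
    show "\<bar>bump p k x\<bar> \<le> B * fact (k + 2) * (x * (1 - x))\<^sup>2"
    proof (cases "0 < x \<and> x < 1")
      case True
      define q where "q = x * (1 - x)"
      have q: "0 < q" using True by (simp add: q_def)
      have "\<bar>bump p k x\<bar> = \<bar>poly p x\<bar> * (exp (- 1 / q) / q ^ k)"
        using True q by (simp add: bump_def q_def abs_mult)
      also have "\<dots> \<le> B * (fact (k + 2) * q ^ (k + 2) / q ^ k)"
        using True B[of x] q exp_minus_inverse_le_power[OF q, of "k + 2"]
        by (intro mult_mono divide_right_mono) (auto simp del: power_add)
      also have "\<dots> = B * fact (k + 2) * q\<^sup>2"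
        using q by (simp add: power_add power2_eq_square)
      finally show ?thesis by (simp add: q_def)
    qed (use B0 in \<open>auto simp: bump_def\<close>)
  qed
qed

lemma bump_has_derivative:
  "(bump p k has_real_derivative
     bump (pderiv p * [:0, 1, -1:] ^ 2 - smult (of_nat k) p * [:1, -2:] * [:0, 1, -1:]
           + p * [:1, -2:]) (k + 2) x) (at x)"
  (is "(_ has_real_derivative bump ?r _ _) _")
proof (cases "0 < x \<and> x < 1")
  case True
  define q where "q = x * (1 - x)"
  have q: "0 < q" using True by (simp add: q_def)
  define i where "i = (\<lambda>x::real. inverse (x * (1 - x)))"
  have i: "(i has_real_derivative - (inverse q ^ 2 * (1 - 2 * x))) (at x)"
    using q unfolding q_def i_def
    by (auto intro!: derivative_eq_intros simp: field_simps power2_eq_square)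
       (simp add: minus_divide_left)
  have ix: "i x = inverse q" by (simp add: i_def q_def)
  have "((\<lambda>x. poly p x * i x ^ k * exp (- i x))
          has_real_derivative
          (poly (pderiv p) x * inverse q ^ k
            - poly p x * (of_nat k * inverse q ^ (k - 1) * (inverse q ^ 2 * (1 - 2 * x)))
            + poly p x * inverse q ^ k * (inverse q ^ 2 * (1 - 2 * x))) * exp (- inverse q)) (at x)"
    by (rule derivative_eq_intros i refl | simp only: ix)+ (simp add: algebra_simps)
  also have "(poly (pderiv p) x * inverse q ^ k
            - poly p x * (of_nat k * inverse q ^ (k - 1) * (inverse q ^ 2 * (1 - 2 * x)))
            + poly p x * inverse q ^ k * (inverse q ^ 2 * (1 - 2 * x))) * exp (- inverse q)
       = bump ?r (k + 2) x"
  proof -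
    have pr: "poly ?r x = poly (pderiv p) x * q ^ 2 - of_nat k * poly p x * (1 - 2 * x) * q
            + poly p x * (1 - 2 * x)"
      by (simp add: q_def algebra_simps)
    have e: "of_nat k * inverse q ^ (k - 1) = of_nat k * inverse q ^ k * q"
      using q by (cases k) auto
    have "bump ?r (k + 2) x = (poly (pderiv p) x * q ^ 2 - of_nat k * poly p x * (1 - 2 * x) * q
            + poly p x * (1 - 2 * x)) * inverse q ^ (k + 2) * exp (- inverse q)"
      using True unfolding bump_def pr q_def[symmetric] by (simp add: divide_inverse power_inverse)
    also have "\<dots> = (poly (pderiv p) x * inverse q ^ k
            - poly p x * (of_nat k * inverse q ^ k * q * (inverse q ^ 2 * (1 - 2 * x)))
            + poly p x * inverse q ^ k * (inverse q ^ 2 * (1 - 2 * x))) * exp (- inverse q)"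
      using q by (simp add: field_simps power_add power2_eq_square)
    finally show ?thesis by (simp only: e)
  qed
  finally show ?thesis
  proof (rule has_field_derivative_transform_within_open[where S="{0<..<1}"])
    fix y :: real assume "y \<in> {0<..<1}"
    thus "poly p y * i y ^ k * exp (- i y) = bump p k y"
      by (simp add: bump_def divide_inverse i_def power_inverse del: inverse_mult_distrib)
  qed (use True in auto)
next
  case False
  have "(bump p k has_real_derivative 0) (at x)"
  proof -
    obtain C where C: "C \<ge> 0" "\<And>x. \<bar>bump p k x\<bar> \<le> C * (x * (1 - x))\<^sup>2"
      using bump_le_square[of p k] by blast
    have "((\<lambda>h. bump p k (x + h) / h) \<longlongrightarrow> 0) (at 0)"
    proof (rule tendsto_rabs_zero_cancel, rule tendsto_sandwich[OF _ _ tendsto_const])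
      have "\<forall>\<^sub>F h in at (0::real). \<bar>h\<bar> < 1"
        unfolding eventually_at by (intro exI[of _ 1]) (auto simp: dist_real_def)
      thus "\<forall>\<^sub>F h in at 0. \<bar>bump p k (x + h) / h\<bar> \<le> C * \<bar>h\<bar>"
        using eventually_neq_at_within[of "0::real"]
      proof eventually_elim
        case (elim h)
        show ?case
        proof (cases "0 < x + h \<and> x + h < 1")
          case True
          have "\<bar>(x + h) * (1 - (x + h))\<bar> \<le> \<bar>h\<bar>"
          proof (cases "x \<le> 0")
            case T: True
            have "(x + h) * (1 - (x + h)) \<le> h * 1" using True T by (intro mult_mono) auto
            thus ?thesis using True by auto
          next
            case F: False
            hence "(x + h) * (1 - (x + h)) \<le> 1 * (-h)" using True False by (intro mult_mono) auto
            thus ?thesis using True by auto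
          qed
          hence "((x + h) * (1 - (x + h)))\<^sup>2 \<le> h\<^sup>2" using abs_le_square_iff by blast
          hence "\<bar>bump p k (x + h)\<bar> \<le> C * h\<^sup>2"
            using C(2)[of "x + h"] C(1) by (meson mult_left_mono order_trans)
          thus ?thesis using elim by (simp add: field_simps power2_eq_square abs_mult_self_eq)
        qed (use C in \<open>auto simp: bump_def\<close>)
      qed
      show "((\<lambda>h. C * \<bar>h\<bar>) \<longlongrightarrow> 0) (at 0)" by (auto intro!: tendsto_eq_intros)
    qed auto
    moreover have "bump p k x = 0" using False by (auto simp: bump_def)
    ultimately show ?thesis by (simp add: DERIV_def)
  qed
  moreover have "bump ?r (k + 2) x = 0" using False by (auto simp: bump_def)
  ultimately show ?thesis by simp
qed

lemma deriv_bump: "\<exists>q l. deriv (bump p k) = bump q l"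
  using DERIV_imp_deriv[OF bump_has_derivative] by blast

lemma higher_deriv_bump: "\<exists>q l. (deriv ^^ j) (bump p k) = bump q l"
  by (induction j) (auto, metis deriv_bump)

lemma bump_differentiable: "(deriv ^^ j) (bump p k) differentiable_on UNIV"
  using higher_deriv_bump[of j p k] bump_has_derivative
  by (metis differentiable_at_imp_differentiable_on real_differentiable_def)

definition smooth :: "(real \<Rightarrow> real) \<Rightarrow> bool" where
  "smooth f \<longleftrightarrow> (\<forall>k. (deriv ^^ k) f differentiable_on UNIV)"

lemma smooth_has_derivative:
  assumes "smooth f"
  shows "((deriv ^^ k) f has_real_derivative (deriv ^^ Suc k) f x) (at x)"
proof -
  have "(deriv ^^ k) f differentiable (at x)"
    using assms by (auto simp: smooth_def differentiable_on_def)
  thus ?thesis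
    using DERIV_deriv_iff_real_differentiable by auto
qed

lemma smooth_affine:
  assumes "smooth f"
  shows "smooth (\<lambda>x. f (c * x + d))"
proof -
  have eq: "(deriv ^^ k) (\<lambda>x. f (c * x + d)) = (\<lambda>x. c ^ k * (deriv ^^ k) f (c * x + d))"
    and D: "((\<lambda>x. c ^ k * (deriv ^^ k) f (c * x + d)) has_real_derivative
           c ^ Suc k * (deriv ^^ Suc k) f (c * x + d)) (at x)" for k x
  proof -
    show D: "((\<lambda>x. c ^ k * (deriv ^^ k) f (c * x + d)) has_real_derivative
           c ^ Suc k * (deriv ^^ Suc k) f (c * x + d)) (at x)" for k x
      by (auto intro!: derivative_eq_intros DERIV_chain2[OF smooth_has_derivative[OF assms]])
    show "(deriv ^^ k) (\<lambda>x. f (c * x + d)) = (\<lambda>x. c ^ k * (deriv ^^ k) f (c * x + d))"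
      by (induction k) (use DERIV_imp_deriv[OF D] in auto)
  qed
  show ?thesis
    unfolding smooth_def eq
    using D by (metis differentiable_at_imp_differentiable_on real_differentiable_def)
qed

lemma smooth_diff:
  assumes "smooth f" "smooth h"
  shows "smooth (\<lambda>x. f x - h x)"
proof -
  have D: "((\<lambda>x. (deriv ^^ k) f x - (deriv ^^ k) h x) has_real_derivative
           (deriv ^^ Suc k) f x - (deriv ^^ Suc k) h x) (at x)" for k x
    by (intro DERIV_diff smooth_has_derivative assms)
  have eq: "(deriv ^^ k) (\<lambda>x. f x - h x) = (\<lambda>x. (deriv ^^ k) f x - (deriv ^^ k) h x)" for k
    by (induction k) (use DERIV_imp_deriv[OF D] in auto)
  show ?thesis
    unfolding smooth_def eq
    using D by (metis differentiable_at_imp_differentiable_on real_differentiable_def)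
qed

lemma smooth_antiderivative:
  assumes "smooth f" and "\<And>x. (F has_real_derivative f x) (at x)"
  shows "smooth F"
  unfolding smooth_def
proof
  fix k
  have "deriv F = f" using assms(2) DERIV_imp_deriv by blast
  show "(deriv ^^ k) F differentiable_on UNIV"
  proof (cases k)
    case 0
    thus ?thesis using assms(2)
      by (metis differentiable_at_imp_differentiable_on real_differentiable_def funpow_0)
  next
    case (Suc j)
    have "(deriv ^^ k) F = (deriv ^^ j) f"
      unfolding Suc funpow_Suc_right by (simp add: \<open>deriv F = f\<close>)
    thus ?thesis using assms(1) by (simp add: smooth_def)
  qed
qed

text \<open>A smoothed Heaviside step: the antiderivative of a nonnegative bump on the unit interval,
  normalised to total increase one.\<close>

lemma smooth_step_exists:
  obtains \<Psi> \<psi> :: "real \<Rightarrow> real" where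
    "smooth \<Psi>" "\<And>x. (\<Psi> has_real_derivative \<psi> x) (at x)" "continuous_on UNIV \<psi>"
    "\<And>x. 0 \<le> \<psi> x" "\<And>x. x \<notin> {0..1} \<Longrightarrow> \<psi> x = 0"
    "\<And>x. x \<le> 0 \<Longrightarrow> \<Psi> x = 0" "\<And>x. 1 \<le> x \<Longrightarrow> \<Psi> x = 1" "\<And>x. 0 \<le> \<Psi> x \<and> \<Psi> x \<le> 1"
proof -
  define b where "b = bump 1 0"
  have sb: "smooth b" unfolding smooth_def b_def using bump_differentiable by blast
  have cb: "isCont b x" for x
    using DERIV_isCont[OF bump_has_derivative] by (simp add: b_def)
  have b0: "0 \<le> b x" for x by (simp add: b_def bump_def)
  have bz: "b x = 0" if "x \<le> 0 \<or> 1 \<le> x" for x using that by (auto simp: b_def bump_def)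
  have bp: "0 < b x" if "0 < x" "x < 1" for x using that by (auto simp: b_def bump_def)
  have "\<exists>F. \<forall>x::real. -\<infinity> < ereal x \<longrightarrow> ereal x < \<infinity> \<longrightarrow> (F has_vector_derivative b x) (at x)"
    by (rule einterval_antiderivative) (auto intro: cb)
  then obtain F where F: "\<And>x. (F has_real_derivative b x) (at x)"
    by (auto simp: has_real_derivative_iff_has_vector_derivative)
  have mono: "F x \<le> F y" if "x \<le> y" for x y
    using F b0 that by (intro DERIV_nonneg_imp_nondecreasing[of x y F]) auto
  have left: "F x = F 0" if "x \<le> 0" for x
  proof (cases "x = 0")
    case False
    with that have "x < 0" by simp
    then obtain z where "x < z" "z < 0" "F 0 - F x = (0 - x) * b z"
      using MVT2[of x 0 F b, OF _ F] by force
    thus ?thesis using bz[of z] by simp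
  qed simp
  have right: "F x = F 1" if "1 \<le> x" for x
  proof (cases "x = 1")
    case False
    with that have "1 < x" by simp
    then obtain z where "1 < z" "z < x" "F x - F 1 = (x - 1) * b z"
      using MVT2[of 1 x F b, OF _ F] by force
    thus ?thesis using bz[of z] by simp
  qed simp
  obtain z where "0 < z" "z < 1" "F 1 - F 0 = (1 - 0) * b z"
    using MVT2[of 0 1 F b, OF _ F] by force
  hence d: "F 0 < F 1" using bp[of z] by simp
  define c where "c = 1 / (F 1 - F 0)"
  have c: "0 < c" using d by (simp add: c_def)
  show ?thesis
  proof (rule that)
    show D: "((\<lambda>x. c * (F x - F 0)) has_real_derivative c * b x) (at x)" for x
      by (auto intro!: derivative_eq_intros F)
    have cc: "continuous_on UNIV b" using cb by (simp add: continuous_at_imp_continuous_on)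
    thus "continuous_on UNIV (\<lambda>x. c * b x)" by (intro continuous_intros)
    have "((\<lambda>x. c * bump 1 0 x)) = (\<lambda>x. bump [:c:] 0 x)"
      by (auto simp: bump_def)
    hence "smooth (\<lambda>x. c * b x)"
      unfolding smooth_def b_def using bump_differentiable by metis
    thus "smooth (\<lambda>x. c * (F x - F 0))" using D smooth_antiderivative by blast
    show "0 \<le> c * b x" for x using c b0 by simp
    show "c * b x = 0" if "x \<notin> {0..1}" for x using bz[of x] that by auto
    show "c * (F x - F 0) = 0" if "x \<le> 0" for x using left[OF that] by simp
    show *: "c * (F x - F 0) = 1" if "1 \<le> x" for x using right[OF that] d by (simp add: c_def)
    show "0 \<le> c * (F x - F 0) \<and> c * (F x - F 0) \<le> 1" for x
    proof -
      have "F 0 \<le> F x" "F x \<le> F 1"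
        using mono[of 0 x] mono[of x 1] left[of x] right[of x] d by (cases "x \<le> 0"; force)+
      thus ?thesis using c d by (simp add: c_def field_simps)
    qed
  qed
qed

lemma test_function_iff:
  "test_function \<eta> \<longleftrightarrow> smooth \<eta> \<and> (\<exists>r. \<forall>x. r < \<bar>x\<bar> \<longrightarrow> \<eta> x = 0)"
proof -
  have "compact (closure {x. \<eta> x \<noteq> 0}) \<longleftrightarrow> bounded {x. \<eta> x \<noteq> 0}" by simp
  also have "\<dots> \<longleftrightarrow> (\<exists>r. \<forall>x. r < \<bar>x\<bar> \<longrightarrow> \<eta> x = 0)"
    unfolding bounded_iff by (auto simp: not_less[symmetric])
  finally show ?thesis by (simp add: test_function_def smooth_def)
qed

lemma test_function_translate:
  assumes "test_function \<eta>"
  shows "test_function (\<lambda>x. \<eta> (x + d))"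
proof -
  obtain r where "\<And>x. r < \<bar>x\<bar> \<Longrightarrow> \<eta> x = 0" using assms test_function_iff by blast
  hence "\<forall>x. r + \<bar>d\<bar> < \<bar>x\<bar> \<longrightarrow> \<eta> (x + d) = 0" by auto
  thus ?thesis using assms smooth_affine[of \<eta> 1 d] unfolding test_function_iff by auto
qed

lemma test_function_deriv:
  assumes "test_function \<eta>"
  shows "(\<eta> has_real_derivative deriv \<eta> x) (at x)"
    and "continuous_on UNIV \<eta>" and "continuous_on UNIV (deriv \<eta>)"
    and "\<exists>r. \<forall>x. r < \<bar>x\<bar> \<longrightarrow> \<eta> x = 0 \<and> deriv \<eta> x = 0"
proof -
  have s: "smooth \<eta>" using assms test_function_iff by blast
  show D: "(\<eta> has_real_derivative deriv \<eta> x) (at x)" for x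
    using smooth_has_derivative[OF s, of 0] by simp
  show "continuous_on UNIV \<eta>" using D DERIV_isCont continuous_at_imp_continuous_on by blast
  show "continuous_on UNIV (deriv \<eta>)"
    by (rule DERIV_continuous_on[where D="deriv (deriv \<eta>)"])
      (use smooth_has_derivative[OF s, of 1] in simp)
  obtain r where r: "\<And>x. r < \<bar>x\<bar> \<Longrightarrow> \<eta> x = 0" using assms test_function_iff by blast
  have "deriv \<eta> x = 0" if "r < \<bar>x\<bar>" for x
  proof -
    have "open {x::real. r < \<bar>x\<bar>}"
      by (rule open_Collect_less[OF continuous_on_const continuous_on_rabs[OF continuous_on_id]])
    hence "(\<eta> has_real_derivative 0) (at x)"
    proof (rule has_field_derivative_transform_within_open[OF DERIV_const[of 0]])
      show "x \<in> {x. r < \<bar>x\<bar>}" using that by simp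
      show "0 = \<eta> y" if "y \<in> {x. r < \<bar>x\<bar>}" for y using r[of y] that by simp
    qed
    thus ?thesis using DERIV_imp_deriv by blast
  qed
  thus "\<exists>r. \<forall>x. r < \<bar>x\<bar> \<longrightarrow> \<eta> x = 0 \<and> deriv \<eta> x = 0" using r by blast
qed

lemma continuous_lebesgue_measurable [measurable (raw)]:
  fixes f :: "real \<Rightarrow> real"
  assumes "continuous_on UNIV f"
  shows "f \<in> borel_measurable lebesgue"
  using borel_measurable_continuous_onI[OF assms] by (simp add: measurable_completion)

lemma continuous_compact_support_bounded:
  fixes \<phi> :: "real \<Rightarrow> real"
  assumes "continuous_on UNIV \<phi>" and "\<And>x. r < \<bar>x\<bar> \<Longrightarrow> \<phi> x = 0"
  obtains B where "B \<ge> 0" "\<And>x. \<bar>\<phi> x\<bar> \<le> B"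
proof -
  have "compact (\<phi> ` {-r..r})"
    using assms(1) continuous_on_subset by (intro compact_continuous_image) auto
  then obtain B where B: "\<And>x. x \<in> {-r..r} \<Longrightarrow> \<bar>\<phi> x\<bar> \<le> B"
    by (metis compact_imp_bounded bounded_iff image_eqI real_norm_def)
  have "\<bar>\<phi> x\<bar> \<le> max B 0" for x
  proof (cases "r < \<bar>x\<bar>")
    case False
    hence "x \<in> {-r..r}" by auto
    thus ?thesis using B[of x] by simp
  qed (simp add: assms(2))
  thus ?thesis using that[of "max B 0"] by auto
qed

lemma integrable_mult_compact_support:
  assumes "locally_integrable f" "continuous_on UNIV \<phi>" "\<And>x. r < \<bar>x\<bar> \<Longrightarrow> \<phi> x = 0"
  shows "integrable lebesgue (\<lambda>x. f x * \<phi> x)"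
proof -
  obtain B where B: "B \<ge> 0" "\<And>x. \<bar>\<phi> x\<bar> \<le> B"
    using continuous_compact_support_bounded assms(2,3) by blast
  have i: "integrable lebesgue (\<lambda>x. indicator {-r..r} x * f x)"
    using assms(1) by (simp add: locally_integrable_def set_integrable_def)
  have [measurable]: "\<phi> \<in> borel_measurable lebesgue"
    using assms(2) by (rule continuous_lebesgue_measurable)
  have "(\<lambda>x. f x * \<phi> x) = (\<lambda>x. (indicator {-r..r} x * f x) * \<phi> x)"
    using assms(3) by (force simp: fun_eq_iff indicator_def)
  moreover have "integrable lebesgue (\<lambda>x. (indicator {-r..r} x * f x) * \<phi> x)"
  proof (rule Bochner_Integration.integrable_bound)
    show "integrable lebesgue (\<lambda>x. B * (indicator {-r..r} x * f x))" using i by simp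
    show "(\<lambda>x. indicat_real {- r..r} x * f x * \<phi> x) \<in> borel_measurable lebesgue"
      using borel_measurable_integrable[OF i] by measurable
    show "AE x in lebesgue. norm (indicat_real {- r..r} x * f x * \<phi> x)
                  \<le> norm (B * (indicat_real {- r..r} x * f x))"
    proof (intro AE_I2)
      fix x
      have "\<bar>indicat_real {- r..r} x * f x\<bar> * \<bar>\<phi> x\<bar> \<le> \<bar>indicat_real {- r..r} x * f x\<bar> * B"
        using B by (intro mult_left_mono) auto
      thus "norm (indicat_real {- r..r} x * f x * \<phi> x)
                  \<le> norm (B * (indicat_real {- r..r} x * f x))"
        using B by (simp add: abs_mult mult_ac)
    qed
  qed
  ultimately show ?thesis by simp
qed

lemma dominated_convergence_on:
  assumes "locally_integrable h" "\<And>n. \<eta> n \<in> borel_measurable lebesgue"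
    "\<And>n x. \<bar>\<eta> n x\<bar> \<le> 1" "\<And>n x. x \<notin> {a..b} \<Longrightarrow> \<eta> n x = 0"
    and lim: "\<And>x. (\<lambda>n. \<eta> n x) \<longlonglongrightarrow> \<phi> x"
  shows "(\<lambda>n::nat. LINT x|lebesgue. h x * \<eta> n x) \<longlonglongrightarrow> (LINT x|lebesgue. h x * \<phi> x)"
proof -
  have i: "integrable lebesgue (\<lambda>x. indicator {a..b} x * h x)"
    using assms(1) by (simp add: locally_integrable_def set_integrable_def)
  note [measurable] = assms(2) borel_measurable_integrable[OF i]
  have \<phi>m [measurable]: "\<phi> \<in> borel_measurable lebesgue"
    using assms(2) lim by (rule borel_measurable_LIMSEQ_metric)
  have e: "h x * \<eta> n x = (indicator {a..b} x * h x) * \<eta> n x" for n x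
    using assms(4) by (auto simp: indicator_def)
  have "\<phi> x = 0" if "x \<notin> {a..b}" for x
    using lim[of x] assms(4)[OF that] by (simp add: LIMSEQ_const_iff)
  hence e': "h x * \<phi> x = (indicator {a..b} x * h x) * \<phi> x" for x
    by (auto simp: indicator_def)
  have "(\<lambda>n. LINT x|lebesgue. (indicator {a..b} x * h x) * \<eta> n x) \<longlonglongrightarrow>
          (LINT x|lebesgue. (indicator {a..b} x * h x) * \<phi> x)"
  proof (rule integral_dominated_convergence[where w="\<lambda>x. \<bar>indicator {a..b} x * h x\<bar>"])
    show "integrable lebesgue (\<lambda>x. \<bar>indicat_real {a..b} x * h x\<bar>)" using i by simp
    show "AE x in lebesgue. norm (indicat_real {a..b} x * h x * \<eta> n x) \<le> \<bar>indicat_real {a..b} x * h x\<bar>" for n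
    proof (intro AE_I2)
      fix x
      show "norm (indicat_real {a..b} x * h x * \<eta> n x) \<le> \<bar>indicat_real {a..b} x * h x\<bar>"
        using mult_left_mono[OF assms(3)[of n x], of "\<bar>indicat_real {a..b} x * h x\<bar>"]
        by (simp add: abs_mult)
    qed
  qed (auto intro!: tendsto_intros lim)
  thus ?thesis by (simp only: e[symmetric] e'[symmetric])
qed

lemma continuous_locally_integrable:
  assumes "continuous_on UNIV f"
  shows "locally_integrable f"
  unfolding locally_integrable_def
proof (intro allI)
  fix u v
  have "continuous_on {u..v} f" using assms continuous_on_subset by blast
  hence i: "integrable lborel (\<lambda>x. indicator {u..v} x *\<^sub>R f x)"
    by (rule borel_integrable_compact[OF compact_Icc])
  from integrable_completion[OF borel_measurable_integrable[OF i]] i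
  show "set_integrable lebesgue {u..v} f" unfolding set_integrable_def by (rule iffD2)
qed

text \<open>The test functions are differences of two smoothed steps of width \<open>1 / n\<close>, one at each endpoint.
  They converge boundedly to the indicator of the interval, and their derivatives are
  approximate identities at \<open>a\<close> and, with negative sign, at \<open>b\<close>.\<close>

lemma interval_test_functions:
  fixes a b :: real
  assumes "a \<le> b"
  obtains \<eta> :: "nat \<Rightarrow> real \<Rightarrow> real" where
    "\<And>n. test_function (\<eta> n)"
    "\<And>h. locally_integrable h \<Longrightarrow>
       (\<lambda>n. LINT x|lebesgue. h x * \<eta> n x) \<longlonglongrightarrow> (LINT x|lebesgue. h x * indicator {a<..b} x)"
    "\<And>f. continuous_on UNIV f \<Longrightarrow>
       (\<lambda>n. LINT x|lebesgue. f x * deriv (\<eta> n) x) \<longlonglongrightarrow> f a - f b"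
proof -
  obtain \<Psi> \<psi> :: "real \<Rightarrow> real" where \<Psi>:
    "smooth \<Psi>" "\<And>x. (\<Psi> has_real_derivative \<psi> x) (at x)" and \<psi>c: "continuous_on UNIV \<psi>"
    and \<psi>0: "\<And>x. 0 \<le> \<psi> x" and \<psi>z: "\<And>x. x \<notin> {0..1} \<Longrightarrow> \<psi> x = 0" and
    \<Psi>0: "\<And>x. x \<le> 0 \<Longrightarrow> \<Psi> x = 0" and \<Psi>1: "\<And>x. 1 \<le> x \<Longrightarrow> \<Psi> x = 1"
    and \<Psi>01: "\<And>x. 0 \<le> \<Psi> x \<and> \<Psi> x \<le> 1"
    using smooth_step_exists by metis
  define s where "s c n x = \<Psi> (real (Suc n) * x + (- real (Suc n) * c))" for c n x
  define d where "d c n x = real (Suc n) * \<psi> (real (Suc n) * x + (- real (Suc n) * c))" for c n x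
  have s_smooth: "smooth (s c n)" for c n
    unfolding s_def[abs_def] by (rule smooth_affine[OF \<Psi>(1)])
  have s_deriv: "(s c n has_real_derivative d c n x) (at x)" for c n x
  proof -
    have "((\<lambda>x. real (Suc n) * x + (- real (Suc n) * c)) has_real_derivative real (Suc n)) (at x)"
      by (auto intro!: derivative_eq_intros)
    from DERIV_chain2[OF \<Psi>(2) this] show ?thesis
      unfolding s_def[abs_def] d_def by (simp only: mult.commute)
  qed
  have s_left: "s c n x = 0" if "x \<le> c" for c n x
    unfolding s_def using mult_left_mono[OF that, of "real (Suc n)"] by (intro \<Psi>0) (simp del: of_nat_Suc)
  have s_right: "s c n x = 1" if "1 \<le> real (Suc n) * (x - c)" for c n x
    unfolding s_def using that by (intro \<Psi>1) (simp add: algebra_simps del: of_nat_Suc)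
  have s_right': "s c n x = 1" if "c + 1 \<le> x" for c n x
  proof (rule s_right)
    have "1 * 1 \<le> real (Suc n) * (x - c)" using that by (intro mult_mono) auto
    thus "1 \<le> real (Suc n) * (x - c)" by simp
  qed
  have s01: "0 \<le> s c n x \<and> s c n x \<le> 1" for c n x unfolding s_def by (rule \<Psi>01)
  have s_lim: "(\<lambda>n. s c n x) \<longlonglongrightarrow> indicator {c<..} x" for c x
  proof (cases "x \<le> c")
    case False
    obtain N where N: "1 / (x - c) < real N" using reals_Archimedean2 by blast
    have "s c n x = 1" if "n \<ge> N" for n
    proof (rule s_right)
      have "1 / (x - c) \<le> real (Suc n)" using N that by simp
      thus "1 \<le> real (Suc n) * (x - c)" using False by (simp add: field_simps del: of_nat_Suc)
    qed
    hence "\<forall>\<^sub>F n in sequentially. s c n x = 1" by (auto simp: eventually_sequentially)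
    thus ?thesis using False by (simp add: tendsto_eventually)
  qed (simp add: s_left)
  \<comment> \<open>Total mass one is what makes the scaled derivatives an approximate identity.\<close>
  have \<psi>int: "(LINT x|lborel. \<psi> x) = 1"
  proof -
    have "(LINT x|lborel. \<psi> x * indicator {0..1} x) = \<Psi> 1 - \<Psi> 0"
      using \<Psi>(2) \<psi>c by (intro integral_FTC_Icc_real) (auto simp: continuous_on_eq_continuous_at)
    moreover have "\<psi> x * indicator {0..1} x = \<psi> x" for x using \<psi>z by (auto simp: indicator_def)
    ultimately show ?thesis by (simp add: \<Psi>0 \<Psi>1)
  qed
  have \<psi>m [measurable]: "\<psi> \<in> borel_measurable borel"
    by (rule borel_measurable_continuous_onI[OF \<psi>c])
  have \<psi>i: "integrable lborel \<psi>"
    using \<psi>int not_integrable_integral_eq by fastforce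
  have dc: "continuous_on UNIV (d c n)" for c n
    unfolding d_def[abs_def]
    by (intro continuous_intros continuous_on_compose2[OF \<psi>c]) auto
  have d_lim: "(\<lambda>n. LINT x|lebesgue. f x * d c n x) \<longlonglongrightarrow> f c"
    if f: "continuous_on UNIV f" for f :: "real \<Rightarrow> real" and c
  proof -
    note [measurable] = borel_measurable_continuous_onI[OF f] borel_measurable_continuous_onI[OF dc]
    have eq: "(LINT x|lebesgue. f x * d c n x) = (LINT x|lborel. f (c + x / Suc n) * \<psi> x)" for n
    proof -
      have "(LINT x|lebesgue. f x * d c n x) = (LINT x|lborel. f x * d c n x)"
        by (intro integral_completion) simp
      also have "\<dots> = \<bar>1 / real (Suc n)\<bar> *\<^sub>R
             (LINT x|lborel. f (c + 1 / real (Suc n) * x) * d c n (c + 1 / real (Suc n) * x))"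
        by (rule lborel_integral_real_affine) simp
      also have "(\<lambda>x. f (c + 1 / real (Suc n) * x) * d c n (c + 1 / real (Suc n) * x))
           = (\<lambda>x. real (Suc n) * (f (c + x / Suc n) * \<psi> x))"
        by (auto simp: d_def field_simps fun_eq_iff simp del: of_nat_Suc)
      finally show ?thesis by simp
    qed
    have "compact (f ` {c..c+1})"
      using f continuous_on_subset by (intro compact_continuous_image) auto
    then obtain B where B: "\<And>x. x \<in> {c..c+1} \<Longrightarrow> \<bar>f x\<bar> \<le> B"
      by (metis compact_imp_bounded bounded_iff image_eqI real_norm_def)
    have "(\<lambda>n. LINT x|lborel. f (c + x / Suc n) * \<psi> x) \<longlonglongrightarrow> (LINT x|lborel. f c * \<psi> x)"
    proof (rule integral_dominated_convergence[where w="\<lambda>x. B * \<psi> x"])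
      show "integrable lborel (\<lambda>x. B * \<psi> x)" using \<psi>i by simp
      show "AE x in lborel. (\<lambda>n. f (c + x / real (Suc n)) * \<psi> x) \<longlonglongrightarrow> f c * \<psi> x"
      proof (intro AE_I2 tendsto_mult_right)
        fix x :: real
        have "(\<lambda>n. x / real (Suc n)) \<longlonglongrightarrow> 0"
          using tendsto_mult[OF tendsto_const[of x] LIMSEQ_inverse_real_of_nat]
          by (simp add: divide_inverse)
        hence "(\<lambda>n. c + x / real (Suc n)) \<longlonglongrightarrow> c + 0" by (intro tendsto_intros)
        thus "(\<lambda>n. f (c + x / real (Suc n))) \<longlonglongrightarrow> f c"
          using f by (intro isCont_tendsto_compose[of c f])
            (auto simp: continuous_on_eq_continuous_at)
      qed
      show "AE x in lborel. norm (f (c + x / real (Suc n)) * \<psi> x) \<le> B * \<psi> x" for n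
      proof (intro AE_I2)
        fix x :: real
        show "norm (f (c + x / real (Suc n)) * \<psi> x) \<le> B * \<psi> x"
        proof (cases "x \<in> {0..1}")
          case True
          have "c + x / real (Suc n) \<in> {c..c+1}" using True by (auto simp: field_simps)
          thus ?thesis using B \<psi>0[of x] by (simp add: abs_mult mult_right_mono del: of_nat_Suc)
        qed (simp add: \<psi>z)
      qed
    qed measurable
    thus ?thesis by (simp only: eq) (simp add: \<psi>int)
  qed
  define \<eta> where "\<eta> n x = s a n x - s b n x" for n x
  have \<eta>test: "test_function (\<eta> n)" for n
  proof -
    have "\<eta> n x = 0" if "\<bar>a\<bar> + \<bar>b\<bar> + 1 < \<bar>x\<bar>" for x
    proof (cases "x \<le> 0")
      case True
      thus ?thesis using that by (simp add: \<eta>_def s_left)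
    next
      case False
      thus ?thesis using that by (simp add: \<eta>_def s_right')
    qed
    thus ?thesis unfolding test_function_iff \<eta>_def[abs_def] using smooth_diff[OF s_smooth s_smooth] by blast
  qed
  have \<eta>deriv: "deriv (\<eta> n) = (\<lambda>x. d a n x - d b n x)" for n
    unfolding \<eta>_def[abs_def] using s_deriv by (intro ext DERIV_imp_deriv DERIV_diff)
  show ?thesis
  proof (rule that[of \<eta>])
    show "(\<lambda>n. LINT x|lebesgue. h x * \<eta> n x) \<longlonglongrightarrow> (LINT x|lebesgue. h x * indicator {a<..b} x)"
      if h: "locally_integrable h" for h
    proof (rule dominated_convergence_on[OF h, where a=a and b="b+1"])
      show "\<eta> n \<in> borel_measurable lebesgue" for n
        by (rule continuous_lebesgue_measurable[OF test_function_deriv(2)[OF \<eta>test]])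
      show "\<bar>\<eta> n x\<bar> \<le> 1" for n x
        using s01[of a n x] s01[of b n x] by (auto simp: \<eta>_def)
      show "\<eta> n x = 0" if "x \<notin> {a..b+1}" for n x
        using that assms s_left[of x a] s_left[of x b] s_right'[of a x] s_right'[of b x]
        by (auto simp: \<eta>_def not_le)
      have "indicator {a<..b} x = indicator {a<..} x - (indicator {b<..} x :: real)" for x
        using assms by (auto simp: indicator_def)
      thus "(\<lambda>n. \<eta> n x) \<longlonglongrightarrow> indicator {a<..b} x" for x
        unfolding \<eta>_def by (auto intro!: tendsto_diff s_lim)
    qed
    show "(\<lambda>n. LINT x|lebesgue. f x * deriv (\<eta> n) x) \<longlonglongrightarrow> f a - f b"
      if f: "continuous_on UNIV f" for f
    proof -
      have li: "locally_integrable f" by (rule continuous_locally_integrable[OF f])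
      have dz: "d c n x = 0" if "\<bar>c\<bar> + 1 < \<bar>x\<bar>" for c n x
      proof -
        have *: "real (Suc n) * x + - real (Suc n) * c \<notin> {0..1}"
        proof (cases "x \<le> c")
          case True
          hence "x < c" using that by auto
          hence "real (Suc n) * (x - c) < 0" by (simp add: mult_pos_neg)
          thus ?thesis by (simp add: algebra_simps)
        next
          case False
          hence "1 < x - c" using that by auto
          hence "1 * 1 < real (Suc n) * (x - c)" by (intro mult_le_less_imp_less) auto
          thus ?thesis by (simp add: algebra_simps)
        qed
        show ?thesis unfolding d_def using \<psi>z[OF *] by simp
      qed
      have i: "integrable lebesgue (\<lambda>x. f x * d c n x)" for c n
        by (rule integrable_mult_compact_support[OF li dc]) (rule dz)
      have "(LINT x|lebesgue. f x * deriv (\<eta> n) x)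
          = (LINT x|lebesgue. f x * d a n x) - (LINT x|lebesgue. f x * d b n x)" for n
        unfolding \<eta>deriv using i by (simp add: right_diff_distrib)
      thus ?thesis using tendsto_diff[OF d_lim[OF f] d_lim[OF f]] by simp
    qed
  qed (rule \<eta>test)
qed

section \<open>Weak derivatives\<close>

text \<open>On a bounded window the sets over which the integral vanishes form a Dynkin system that contains
  the intervals, hence all Borel sets, and null sets extend this to all Lebesgue sets.\<close>

lemma AE_zero_if_interval_integrals_zero:
  assumes li: "locally_integrable h"
    and zero: "\<And>a b. a \<le> b \<Longrightarrow> (LINT x|lebesgue. h x * indicator {a<..b} x) = 0"
  shows "AE x in lebesgue. h x = 0"
proof -
  have "AE x in lebesgue. indicator {-real n..real n} x * h x = 0" for n
  proof -
    define r where "r = real n"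
    define k where "k x = indicator {-r..r} x * h x" for x
    have i: "integrable lebesgue k"
      using li unfolding k_def[abs_def] by (simp add: locally_integrable_def set_integrable_def)
    have ii: "integrable lebesgue (\<lambda>x. indicator A x * k x)" if "A \<in> sets lebesgue" for A
      using integrable_mult_indicator[OF that i] by simp
    have Icc: "(LINT x|lebesgue. indicator {a..b} x * k x) = 0" for a b
    proof (cases "max a (-r) \<le> min b r")
      case True
      have "AE x in lebesgue. x \<notin> {max a (-r)}"
        by (intro AE_not_in null_sets_completionI finite_imp_null_set_lborel) simp
      hence "AE x in lebesgue. indicator {a..b} x * k x = h x * indicator {max a (-r)<..min b r} x"
        by eventually_elim (auto simp: k_def indicator_def)
      moreover have "(\<lambda>x. h x * indicator {max a (-r)<..min b r} x) \<in> borel_measurable lebesgue"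
      proof -
        have "(\<lambda>x. indicator {max a (-r)<..min b r} x * k x) \<in> borel_measurable lebesgue"
          by (rule borel_measurable_integrable[OF ii]) simp
        also have "(\<lambda>x. indicator {max a (-r)<..min b r} x * k x)
            = (\<lambda>x. h x * indicator {max a (-r)<..min b r} x)"
          by (auto simp: k_def indicator_def fun_eq_iff)
        finally show ?thesis .
      qed
      ultimately have "(LINT x|lebesgue. indicator {a..b} x * k x)
          = (LINT x|lebesgue. h x * indicator {max a (-r)<..min b r} x)"
        by (intro integral_cong_AE borel_measurable_integrable[OF ii]) auto
      thus ?thesis using zero[OF True] by simp
    next
      case False
      hence "(\<lambda>x. indicator {a..b} x * k x) = (\<lambda>_. 0)"
        by (auto simp: k_def indicator_def fun_eq_iff)
      thus ?thesis by simp
    qed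
    have all: "(LINT x|lebesgue. k x) = 0"
    proof -
      have "k = (\<lambda>x. indicator {-r..r} x * k x)" by (auto simp: k_def indicator_def fun_eq_iff)
      thus ?thesis using Icc[of "-r" r] by simp
    qed
    have borel: "(LINT x|lebesgue. indicator A x * k x) = 0" if "A \<in> sets borel" for A
      using that
    proof (induction rule: borel_set_induct)
      case (compl A)
      have "indicator (-A) x * k x = k x - indicator A x * k x" for x
        by (simp add: indicator_def)
      thus ?case using all compl i ii[of A] by simp
    next
      case (union F)
      have "(LINT x:(\<Union>i. F i)|lebesgue. k x) = (\<Sum>i. (LINT x:(F i)|lebesgue. k x))"
      proof (rule lebesgue_integral_countable_add)
        show "set_integrable lebesgue (\<Union>i. F i) k"
          unfolding set_integrable_def using ii[of "\<Union>i. F i"] union by simp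
      qed (use union in \<open>auto simp: disjoint_family_on_def\<close>)
      thus ?case using union by (simp add: set_lebesgue_integral_def)
    qed (use Icc in simp_all)
    have "AE x in lebesgue. k x = 0"
    proof (rule density_unique_real[OF i])
      fix A :: "real set" assume A: "A \<in> sets lebesgue"
      then obtain S N N' where S: "A = S \<union> N" "N \<subseteq> N'" "N' \<in> null_sets lborel" "S \<in> sets lborel"
        by (rule sets_completionE)
      have "(LINT x:A|lebesgue. k x) = (LINT x:S|lebesgue. k x)"
      proof (rule set_integral_null_delta[OF i A])
        show "A - S \<union> (S - A) \<in> null_sets lebesgue"
          by (rule null_sets_completion_subset[of _ N']) (use S in \<open>auto intro: null_sets_completionI\<close>)
      qed (use S in simp)
      also have "\<dots> = 0" using borel[of S] S by (simp add: set_lebesgue_integral_def)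
      finally show "(LINT x:A|lebesgue. k x) = (LINT x:A|lebesgue. 0)" by simp
    qed simp
    thus ?thesis by (simp add: k_def[abs_def] r_def)
  qed
  hence "AE x in lebesgue. \<forall>n. indicator {-real n..real n} x * h x = 0"
    unfolding AE_all_countable by blast
  thus ?thesis
  proof eventually_elim
    case (elim x)
    obtain n where "\<bar>x\<bar> \<le> real n" using real_arch_simple by blast
    hence "x \<in> {-real n..real n}" by auto
    thus ?case using elim by (metis indicator_simps(1) mult_1)
  qed
qed

lemma locally_integrable_lincomb:
  assumes "locally_integrable f" "locally_integrable h"
  shows "locally_integrable (\<lambda>x. c * f x + d * h x)"
  using assms unfolding locally_integrable_def
  by (intro allI set_integral_add set_integrable_mult_right) auto

lemma test_function_integrable:
  assumes "locally_integrable f" "test_function \<eta>"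
  shows "integrable lebesgue (\<lambda>x. f x * \<eta> x)" "integrable lebesgue (\<lambda>x. f x * deriv \<eta> x)"
  using test_function_deriv(4)[OF assms(2)]
    integrable_mult_compact_support[OF assms(1) test_function_deriv(2)[OF assms(2)]]
    integrable_mult_compact_support[OF assms(1) test_function_deriv(3)[OF assms(2)]]
  by metis+

lemma has_weak_deriv_lincomb:
  assumes "has_weak_deriv f f'" "has_weak_deriv h h'"
  shows "has_weak_deriv (\<lambda>x. c * f x + d * h x) (\<lambda>x. c * f' x + d * h' x)"
proof -
  have li: "locally_integrable f" "locally_integrable h" "locally_integrable f'" "locally_integrable h'"
    using assms by (auto simp: has_weak_deriv_def)
  have "(LINT x|lebesgue. (c * f x + d * h x) * deriv \<eta> x)
      = - (LINT x|lebesgue. (c * f' x + d * h' x) * \<eta> x)" if t: "test_function \<eta>" for \<eta>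
  proof -
    note i = test_function_integrable[OF _ t]
    have "(LINT x|lebesgue. (c * f x + d * h x) * deriv \<eta> x)
      = c * (LINT x|lebesgue. f x * deriv \<eta> x) + d * (LINT x|lebesgue. h x * deriv \<eta> x)"
      using i(2)[OF li(1)] i(2)[OF li(2)] by (simp add: distrib_right mult.assoc)
    moreover have "(LINT x|lebesgue. (c * f' x + d * h' x) * \<eta> x)
      = c * (LINT x|lebesgue. f' x * \<eta> x) + d * (LINT x|lebesgue. h' x * \<eta> x)"
      using i(1)[OF li(3)] i(1)[OF li(4)] by (simp add: distrib_right mult.assoc)
    ultimately show ?thesis using assms t by (simp add: has_weak_deriv_def)
  qed
  thus ?thesis using li locally_integrable_lincomb unfolding has_weak_deriv_def by blast
qed

text \<open>The difference annihilates every test function, in particular those that approximate the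
  indicator of an interval; so its integral over each interval is zero.\<close>

lemma has_weak_deriv_unique:
  assumes "has_weak_deriv f f1" "has_weak_deriv f f2"
  shows "AE x in lebesgue. f1 x = f2 x"
proof -
  define h where "h x = 1 * f1 x + (-1) * f2 x" for x
  have w: "has_weak_deriv (\<lambda>x. 1 * f x + (-1) * f x) h"
    unfolding h_def[abs_def] by (rule has_weak_deriv_lincomb[OF assms])
  hence li: "locally_integrable h" by (simp add: has_weak_deriv_def)
  have z: "(LINT x|lebesgue. h x * \<eta> x) = 0" if "test_function \<eta>" for \<eta>
    using w that by (simp add: has_weak_deriv_def)
  have "AE x in lebesgue. h x = 0"
  proof (rule AE_zero_if_interval_integrals_zero[OF li])
    fix a b :: real assume "a \<le> b"
    then obtain \<eta> :: "nat \<Rightarrow> real \<Rightarrow> real" where \<eta>: "\<And>n. test_function (\<eta> n)"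
      "(\<lambda>n. LINT x|lebesgue. h x * \<eta> n x) \<longlonglongrightarrow> (LINT x|lebesgue. h x * indicator {a<..b} x)"
      using interval_test_functions[of a b] li by metis
    show "(LINT x|lebesgue. h x * indicator {a<..b} x) = 0"
      using \<eta> by (simp add: z LIMSEQ_const_iff)
  qed
  thus ?thesis by eventually_elim (simp add: h_def)
qed

lemma has_weak_deriv_weak_deriv:
  assumes "has_weak_deriv f f'"
  shows "has_weak_deriv f (weak_deriv f)"
  using assms unfolding weak_deriv_def by (rule someI[where P="has_weak_deriv f"])

lemma weak_deriv_AE_eq:
  assumes "has_weak_deriv f f'"
  shows "AE x in lebesgue. weak_deriv f x = f' x"
  using has_weak_deriv_unique[OF has_weak_deriv_weak_deriv[OF assms] assms] .

text \<open>Testing with approximate indicators of the interval turns one side of the defining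
  identity into the integral of the weak derivative and the other into the boundary values.\<close>

lemma weak_deriv_FTC:
  assumes "has_weak_deriv f f'" "continuous_on UNIV f" "a \<le> b"
  shows "(LINT x|lebesgue. f' x * indicator {a<..b} x) = f b - f a"
proof (rule interval_test_functions[OF assms(3)])
  fix \<eta> :: "nat \<Rightarrow> real \<Rightarrow> real"
  assume test: "\<And>n. test_function (\<eta> n)"
    and lim: "\<And>h. locally_integrable h \<Longrightarrow>
       (\<lambda>n. LINT x|lebesgue. h x * \<eta> n x) \<longlonglongrightarrow> (LINT x|lebesgue. h x * indicator {a<..b} x)"
    and lim': "\<And>f. continuous_on UNIV f \<Longrightarrow>
       (\<lambda>n. LINT x|lebesgue. f x * deriv (\<eta> n) x) \<longlonglongrightarrow> f a - f b"
  have "locally_integrable f'" using assms(1) by (simp add: has_weak_deriv_def)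
  note 1 = tendsto_minus[OF lim[OF this]]
  have "(LINT x|lebesgue. f x * deriv (\<eta> n) x) = - (LINT x|lebesgue. f' x * \<eta> n x)" for n
    using assms(1) test by (simp add: has_weak_deriv_def)
  hence "(\<lambda>n. - (LINT x|lebesgue. f' x * \<eta> n x)) \<longlonglongrightarrow> f a - f b"
    using lim'[OF assms(2)] by simp
  from LIMSEQ_unique[OF this 1] show ?thesis by simp
qed

lemma locally_integrable_measurable:
  assumes "locally_integrable f"
  shows "f \<in> borel_measurable lebesgue"
proof (rule borel_measurable_LIMSEQ_metric)
  show "(\<lambda>x. indicator {-real n..real n} x * f x) \<in> borel_measurable lebesgue" for n
    using assms by (auto simp: locally_integrable_def set_integrable_def dest: borel_measurable_integrable)
  fix x
  obtain N where N: "\<bar>x\<bar> \<le> real N" using real_arch_simple by blast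
  have "indicator {-real n..real n} x * f x = f x" if "n \<ge> N" for n
  proof -
    have "x \<in> {-real n..real n}" using N that by (auto simp: abs_le_iff)
    thus ?thesis by simp
  qed
  hence "\<forall>\<^sub>F n in sequentially. indicator {-real n..real n} x * f x = f x"
    by (auto simp: eventually_sequentially)
  thus "(\<lambda>n. indicator {-real n..real n} x * f x) \<longlonglongrightarrow> f x"
    by (rule tendsto_eventually)
qed

section \<open>The space of square-integrable functions\<close>

lemma L2_norm_nonneg [simp]: "0 \<le> L2_norm f"
  by (simp add: L2_norm_def)

lemma L2_norm_square: "(L2_norm f)\<^sup>2 = (LINT x|lebesgue. (f x)\<^sup>2)"
  by (simp add: L2_norm_def)

lemma L2_mult_integrable:
  assumes "f \<in> L2_space" "h \<in> L2_space"
  shows "integrable lebesgue (\<lambda>x. f x * h x)"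
proof (rule Bochner_Integration.integrable_bound)
  show "integrable lebesgue (\<lambda>x. (f x)\<^sup>2 + (h x)\<^sup>2)" using assms by (simp add: L2_space_def)
  show "(\<lambda>x. f x * h x) \<in> borel_measurable lebesgue"
    using assms by (auto simp: L2_space_def intro!: borel_measurable_times)
  show "AE x in lebesgue. norm (f x * h x) \<le> norm ((f x)\<^sup>2 + (h x)\<^sup>2)"
  proof (intro AE_I2)
    fix x
    have "2 * (\<bar>f x\<bar> * \<bar>h x\<bar>) \<le> (f x)\<^sup>2 + (h x)\<^sup>2"
      using sum_squares_bound[of "\<bar>f x\<bar>" "\<bar>h x\<bar>"] by simp
    moreover have "0 \<le> \<bar>f x\<bar> * \<bar>h x\<bar>" by simp
    ultimately have "\<bar>f x\<bar> * \<bar>h x\<bar> \<le> (f x)\<^sup>2 + (h x)\<^sup>2" by linarith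
    thus "norm (f x * h x) \<le> norm ((f x)\<^sup>2 + (h x)\<^sup>2)" by (simp add: abs_mult)
  qed
qed

lemma L2_lincomb:
  assumes "f \<in> L2_space" "h \<in> L2_space"
  shows "(\<lambda>x. c * f x + d * h x) \<in> L2_space"
proof -
  have "(c * f x + d * h x)\<^sup>2 = c\<^sup>2 * (f x)\<^sup>2 + (2 * c * d) * (f x * h x) + d\<^sup>2 * (h x)\<^sup>2" for x
    by (simp add: power2_eq_square algebra_simps)
  moreover have "(\<lambda>x. c * f x + d * h x) \<in> borel_measurable lebesgue"
    using assms by (auto simp: L2_space_def intro!: borel_measurable_times borel_measurable_add)
  ultimately show ?thesis using assms L2_mult_integrable[OF assms] by (simp add: L2_space_def)
qed

text \<open>The quadratic \<open>\<parallel>f - t h\<parallel>\<^sup>2\<close> in \<open>t\<close> is nonnegative.\<close>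

lemma L2_Cauchy_Schwarz:
  assumes "f \<in> L2_space" "h \<in> L2_space"
  shows "\<bar>LINT x|lebesgue. f x * h x\<bar> \<le> L2_norm f * L2_norm h"
proof -
  define A B C where "A = (LINT x|lebesgue. (f x)\<^sup>2)" and "B = (LINT x|lebesgue. f x * h x)"
    and "C = (LINT x|lebesgue. (h x)\<^sup>2)"
  have q: "0 \<le> A - 2 * t * B + t\<^sup>2 * C" for t
  proof -
    have "0 \<le> (LINT x|lebesgue. (f x - t * h x)\<^sup>2)" by simp
    also have "(\<lambda>x. (f x - t * h x)\<^sup>2) = (\<lambda>x. (f x)\<^sup>2 - 2 * t * (f x * h x) + t\<^sup>2 * (h x)\<^sup>2)"
      by (auto simp: power2_eq_square algebra_simps)
    also have "(LINT x|lebesgue. \<dots> x) = A - 2 * t * B + t\<^sup>2 * C"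
      using assms L2_mult_integrable[OF assms] by (simp add: L2_space_def A_def B_def C_def)
    finally show ?thesis .
  qed
  have A: "0 \<le> A" and C: "0 \<le> C" by (simp_all add: A_def C_def)
  \<comment> \<open>The quadratic is evaluated at its minimum, or, if it is affine, at a point where a nonzero slope would make it negative.\<close>
  have "B\<^sup>2 \<le> A * C"
  proof (cases "C = 0")
    case True
    have "B = 0"
    proof (rule ccontr)
      assume "B \<noteq> 0"
      thus False using q[of "(A + 1) / (2 * B)"] True by simp
    qed
    thus ?thesis using True by simp
  next
    case False
    hence "0 < C" using C by simp
    thus ?thesis using q[of "B / C"] by (simp add: field_simps power2_eq_square)
  qed
  hence "sqrt (B\<^sup>2) \<le> sqrt (A * C)" by (rule real_sqrt_le_mono)
  thus ?thesis by (simp add: L2_norm_def A_def B_def C_def real_sqrt_mult)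
qed

lemma L2_norm_lincomb:
  assumes "f \<in> L2_space" "h \<in> L2_space"
  shows "L2_norm (\<lambda>x. c * f x + d * h x) \<le> \<bar>c\<bar> * L2_norm f + \<bar>d\<bar> * L2_norm h"
proof -
  have "(L2_norm (\<lambda>x. c * f x + d * h x))\<^sup>2
      = (LINT x|lebesgue. c\<^sup>2 * (f x)\<^sup>2 + (2 * c * d) * (f x * h x) + d\<^sup>2 * (h x)\<^sup>2)"
    unfolding L2_norm_square
    by (intro Bochner_Integration.integral_cong refl) (simp add: power2_eq_square algebra_simps)
  also have "\<dots> = c\<^sup>2 * (L2_norm f)\<^sup>2 + (2 * c * d) * (LINT x|lebesgue. f x * h x) + d\<^sup>2 * (L2_norm h)\<^sup>2"
    using assms L2_mult_integrable[OF assms] by (simp add: L2_space_def L2_norm_square)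
  also have "\<dots> \<le> c\<^sup>2 * (L2_norm f)\<^sup>2 + \<bar>2 * c * d\<bar> * (L2_norm f * L2_norm h) + d\<^sup>2 * (L2_norm h)\<^sup>2"
  proof -
    have "(2 * c * d) * (LINT x|lebesgue. f x * h x) \<le> \<bar>2 * c * d\<bar> * \<bar>LINT x|lebesgue. f x * h x\<bar>"
      by (metis abs_ge_self abs_mult)
    also have "\<dots> \<le> \<bar>2 * c * d\<bar> * (L2_norm f * L2_norm h)"
      by (intro mult_left_mono L2_Cauchy_Schwarz assms) simp
    finally show ?thesis by simp
  qed
  also have "\<dots> = (\<bar>c\<bar> * L2_norm f + \<bar>d\<bar> * L2_norm h)\<^sup>2"
    by (simp add: power2_sum power_mult_distrib abs_mult)
  finally show ?thesis by (rule power2_le_imp_le) simp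
qed

lemma L2_cong_AE:
  assumes "f \<in> L2_space" "h \<in> borel_measurable lebesgue" "AE x in lebesgue. h x = f x"
  shows "h \<in> L2_space" and "L2_norm h = L2_norm f"
proof -
  have m: "f \<in> borel_measurable lebesgue" using assms(1) by (simp add: L2_space_def)
  have ae: "AE x in lebesgue. (h x)\<^sup>2 = (f x)\<^sup>2" using assms(3) by eventually_elim simp
  show "L2_norm h = L2_norm f"
    unfolding L2_norm_def using integral_cong_AE[OF _ _ ae] m assms(2) by simp
  show "h \<in> L2_space"
    using assms(1) integrable_cong_AE[OF _ _ ae] m assms(2) by (simp add: L2_space_def)
qed

lemma L2_dominated:
  assumes "h \<in> L2_space" "f \<in> borel_measurable lebesgue" "\<And>x. \<bar>f x\<bar> \<le> c * \<bar>h x\<bar>" "0 \<le> c"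
  shows "f \<in> L2_space" "L2_norm f \<le> c * L2_norm h"
proof -
  have le: "(f x)\<^sup>2 \<le> c\<^sup>2 * (h x)\<^sup>2" for x
    using power_mono[OF assms(3)[of x], of 2] by (simp add: power_mult_distrib)
  have i: "integrable lebesgue (\<lambda>x. c\<^sup>2 * (h x)\<^sup>2)" using assms(1) by (simp add: L2_space_def)
  have j: "integrable lebesgue (\<lambda>x. (f x)\<^sup>2)"
    by (rule Bochner_Integration.integrable_bound[OF i]) (use assms(2) le in auto)
  thus "f \<in> L2_space" using assms(2) by (simp add: L2_space_def)
  have "(L2_norm f)\<^sup>2 \<le> (c * L2_norm h)\<^sup>2"
    unfolding power_mult_distrib L2_norm_square
    using integral_mono[OF j i le] by simp
  thus "L2_norm f \<le> c * L2_norm h" by (rule power2_le_imp_le) (use assms(4) in simp)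
qed

section \<open>The Sobolev space as a normed space\<close>

lemma H1_spaceD:
  assumes "f \<in> H1_space"
  shows "continuous_on UNIV f" "f \<in> L2_space" "has_weak_deriv f (weak_deriv f)"
    "weak_deriv f \<in> L2_space"
proof -
  show "continuous_on UNIV f" "f \<in> L2_space" using assms by (auto simp: H1_space_def)
  obtain f' where f': "has_weak_deriv f f'" "f' \<in> L2_space" using assms by (auto simp: H1_space_def)
  show w: "has_weak_deriv f (weak_deriv f)" by (rule has_weak_deriv_weak_deriv[OF f'(1)])
  show "weak_deriv f \<in> L2_space"
    using L2_cong_AE[OF f'(2) _ weak_deriv_AE_eq[OF f'(1)]] w locally_integrable_measurable
    by (auto simp: has_weak_deriv_def)
qed

lemma L2_norm_weak_deriv:
  assumes "has_weak_deriv f f'" "f' \<in> L2_space"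
  shows "L2_norm (weak_deriv f) = L2_norm f'"
  using L2_cong_AE[OF assms(2) _ weak_deriv_AE_eq[OF assms(1)]]
    has_weak_deriv_weak_deriv[OF assms(1)] locally_integrable_measurable
  by (auto simp: has_weak_deriv_def)

lemma H1_norm_nonneg [simp]: "0 \<le> H1_norm f"
  by (simp add: H1_norm_def)

lemma H1_norm_square: "(H1_norm f)\<^sup>2 = (L2_norm f)\<^sup>2 + (L2_norm (weak_deriv f))\<^sup>2"
  by (simp add: H1_norm_def)

lemma L2_norm_le_H1_norm: "L2_norm f \<le> H1_norm f"
  by (rule power2_le_imp_le) (simp_all add: H1_norm_square)

lemma H1_lincomb:
  assumes "f \<in> H1_space" "h \<in> H1_space"
  shows "(\<lambda>x. c * f x + d * h x) \<in> H1_space"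
    and "H1_norm (\<lambda>x. c * f x + d * h x) \<le> \<bar>c\<bar> * H1_norm f + \<bar>d\<bar> * H1_norm h"
proof -
  note f = H1_spaceD[OF assms(1)] and h = H1_spaceD[OF assms(2)]
  have w: "has_weak_deriv (\<lambda>x. c * f x + d * h x) (\<lambda>x. c * weak_deriv f x + d * weak_deriv h x)"
    by (rule has_weak_deriv_lincomb[OF f(3) h(3)])
  have w2: "(\<lambda>x. c * weak_deriv f x + d * weak_deriv h x) \<in> L2_space"
    by (rule L2_lincomb[OF f(4) h(4)])
  show "(\<lambda>x. c * f x + d * h x) \<in> H1_space"
    using w w2 L2_lincomb[OF f(2) h(2)] f(1) h(1)
    by (auto simp: H1_space_def intro!: continuous_intros)
  have "H1_norm (\<lambda>x. c * f x + d * h x) = sqrt ((L2_norm (\<lambda>x. c * f x + d * h x))\<^sup>2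
      + (L2_norm (\<lambda>x. c * weak_deriv f x + d * weak_deriv h x))\<^sup>2)"
    unfolding H1_norm_def L2_norm_weak_deriv[OF w w2] ..
  also have "\<dots> \<le> sqrt ((\<bar>c\<bar> * L2_norm f + \<bar>d\<bar> * L2_norm h)\<^sup>2
     + (\<bar>c\<bar> * L2_norm (weak_deriv f) + \<bar>d\<bar> * L2_norm (weak_deriv h))\<^sup>2)"
    by (intro real_sqrt_le_mono add_mono power_mono L2_norm_lincomb f h) auto
  also have "\<dots> \<le> sqrt ((\<bar>c\<bar> * L2_norm f)\<^sup>2 + (\<bar>c\<bar> * L2_norm (weak_deriv f))\<^sup>2)
      + sqrt ((\<bar>d\<bar> * L2_norm h)\<^sup>2 + (\<bar>d\<bar> * L2_norm (weak_deriv h))\<^sup>2)"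
    by (rule real_sqrt_sum_squares_triangle_ineq)
  also have "\<dots> = \<bar>c\<bar> * H1_norm f + \<bar>d\<bar> * H1_norm h"
    by (simp add: power_mult_distrib distrib_left[symmetric] real_sqrt_mult H1_norm_def)
  finally show "H1_norm (\<lambda>x. c * f x + d * h x) \<le> \<bar>c\<bar> * H1_norm f + \<bar>d\<bar> * H1_norm h" .
qed

section \<open>The Sobolev inequality with sharp constant\<close>

text \<open>Product measurability and substitution are used for Borel functions on \<^const>\<open>lborel\<close>, whereas the
  function spaces live on \<^const>\<open>lebesgue\<close>; this lemma and the next are the passage between them.\<close>

lemma integrable_lebesgue_borel_version:
  fixes f :: "real \<Rightarrow> real"
  assumes "integrable lebesgue f"
  obtains k where "integrable lborel k" "AE x in lebesgue. f x = k x" "AE x in lborel. f x = k x"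
proof -
  obtain k where k: "k \<in> borel_measurable lborel" "AE x in lborel. f x = k x"
    using completion_ex_borel_measurable_real[of f lborel] assms borel_measurable_integrable by blast
  have ae: "AE x in lebesgue. f x = k x" using k(2) by (rule AE_completion)
  have "integrable lebesgue k"
    using integrable_cong_AE_imp[OF assms measurable_completion[OF k(1)]] ae by auto
  hence "integrable lborel k" using integrable_completion[OF k(1)] by simp
  thus ?thesis using that ae k by blast
qed

lemma integral_borel_version:
  fixes f k \<phi> :: "real \<Rightarrow> real"
  assumes "integrable lborel k" "f \<in> borel_measurable lebesgue" "AE x in lebesgue. f x = k x"
    and \<phi> [measurable]: "\<phi> \<in> borel_measurable borel"
  shows "(LINT x|lborel. k x * \<phi> x) = (LINT x|lebesgue. f x * \<phi> x)"
proof -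
  note [measurable] = borel_measurable_integrable[OF assms(1)] assms(2)
  have "(LINT x|lborel. k x * \<phi> x) = (LINT x|lebesgue. k x * \<phi> x)"
    by (rule integral_completion[symmetric]) simp
  also have "\<dots> = (LINT x|lebesgue. f x * \<phi> x)"
  proof (rule integral_cong_AE)
    show "AE x in lebesgue. k x * \<phi> x = f x * \<phi> x"
      using assms(3) by eventually_elim simp
    have "\<phi> \<in> borel_measurable lebesgue" "k \<in> borel_measurable lebesgue"
      by (rule measurable_completion; simp)+
    thus "(\<lambda>x. f x * \<phi> x) \<in> borel_measurable lebesgue"
      "(\<lambda>x. k x * \<phi> x) \<in> borel_measurable lebesgue" by measurable
  qed
  finally show ?thesis .
qed

text \<open>The product rule for \<open>f\<^sup>2\<close>. The double integral of \<open>f' s f' t\<close> over the triangle \<open>s \<le> t\<close> is evaluated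
  in both orders: integrating \<open>s\<close> first yields \<open>\<integral> f' (f - f a)\<close>, integrating \<open>t\<close> first yields
  \<open>\<integral> f' (f b - f)\<close>.\<close>

lemma weak_deriv_square_FTC:
  assumes w: "has_weak_deriv f f'" and c: "continuous_on UNIV f" and ab: "a \<le> b"
  shows "(f b)\<^sup>2 - (f a)\<^sup>2 = 2 * (LINT x|lebesgue. f' x * f x * indicator {a<..b} x)"
proof -
  have "integrable lebesgue (\<lambda>x. indicator {a..b} x *\<^sub>R f' x)"
    using w by (simp add: has_weak_deriv_def locally_integrable_def set_integrable_def)
  hence i: "integrable lebesgue (\<lambda>x. f' x * indicator {a<..b} x)"
  proof -
    assume "integrable lebesgue (\<lambda>x. indicator {a..b} x *\<^sub>R f' x)"
    from integrable_mult_indicator[OF _ this, of "{a<..b}"]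
    show ?thesis
      by (rule back_subst[of "integrable lebesgue"]) (auto simp: indicator_def fun_eq_iff)
  qed
  obtain k where k: "integrable lborel k" "AE x in lebesgue. f' x * indicator {a<..b} x = k x"
    using integrable_lebesgue_borel_version[OF i] by metis
  note [measurable] = borel_measurable_integrable[OF k(1)] borel_measurable_continuous_onI[OF c]
    borel_measurable_integrable[OF i]
  have conv: "(LINT x|lborel. k x * \<phi> x) = (LINT x|lebesgue. (f' x * indicator {a<..b} x) * \<phi> x)"
    if "\<phi> \<in> borel_measurable borel" for \<phi>
    using integral_borel_version[OF k(1) borel_measurable_integrable[OF i] k(2) that] .
  \<comment> \<open>These are the inner integrals of the two orders of integration.\<close>
  have lower: "(LINT s|lborel. k s * indicator {..t} s) = f t - f a" if "t \<in> {a<..b}" for t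
  proof -
    have "(LINT s|lborel. k s * indicator {..t} s)
        = (LINT s|lebesgue. (f' s * indicator {a<..b} s) * indicator {..t} s)"
      by (rule conv) simp
    also have "(\<lambda>s. (f' s * indicator {a<..b} s) * indicator {..t} s) = (\<lambda>s. f' s * indicator {a<..t} s)"
      using that by (auto simp: indicator_def fun_eq_iff)
    finally show ?thesis using weak_deriv_FTC[OF w c, of a t] that by simp
  qed
  have upper: "(LINT s|lborel. k s * indicator {t..} s) = f b - f t" if "t \<in> {a<..b}" for t
  proof -
    have "AE s in lborel. s \<notin> {t}" by (intro AE_not_in finite_imp_null_set_lborel) simp
    hence "AE s in lborel. k s * indicator {t..} s = k s * indicator {t<..} s"
      by eventually_elim (auto simp: indicator_def)
    hence "(LINT s|lborel. k s * indicator {t..} s) = (LINT s|lborel. k s * indicator {t<..} s)"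
      by (intro integral_cong_AE) auto
    also have "\<dots> = (LINT s|lebesgue. (f' s * indicator {a<..b} s) * indicator {t<..} s)"
      by (rule conv) simp
    also have "(\<lambda>s. (f' s * indicator {a<..b} s) * indicator {t<..} s) = (\<lambda>s. f' s * indicator {t<..b} s)"
      using that by (auto simp: indicator_def fun_eq_iff)
    finally show ?thesis using weak_deriv_FTC[OF w c, of t b] that by simp
  qed
  have k_supp: "AE x in lborel. k x = k x * indicator {a<..b} x"
  proof -
    have "AE x in lebesgue. k x = k x * indicator {a<..b} x"
      using k(2)
    proof eventually_elim
      case (elim x)
      thus ?case by (cases "x \<in> {a<..b}") auto
    qed
    thus ?thesis by (simp add: AE_completion_iff)
  qed
  have "(LINT t|lborel. LINT s|lborel. k s * k t * indicator {..t} s)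
      = (LINT s|lborel. LINT t|lborel. k s * k t * indicator {..t} s)"
  proof (rule lborel_pair.Fubini_integral)
    have kk: "integrable (lborel \<Otimes>\<^sub>M lborel) (\<lambda>(s, t). k s * k t)"
    proof (rule lborel_pair.Fubini_integrable)
      show "integrable lborel (\<lambda>x. LINT y|lborel. norm (case (x, y) of (s, t) \<Rightarrow> k s * k t))"
        using k(1) by (simp add: abs_mult)
    qed (use k(1) in \<open>auto\<close>)
    show "integrable (lborel \<Otimes>\<^sub>M lborel) (\<lambda>(s, t). k s * k t * indicator {..t} s)"
    proof (rule Bochner_Integration.integrable_bound[OF kk])
      have "(\<lambda>(s, t). k s * k t * indicator {(s::real,t). s \<le> t} (s, t)) \<in> borel_measurable (lborel \<Otimes>\<^sub>M lborel)"
        by measurable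
      thus "(\<lambda>(s, t). k s * k t * indicator {..t} s) \<in> borel_measurable (lborel \<Otimes>\<^sub>M lborel)"
        by (rule back_subst) (auto simp: indicator_def fun_eq_iff)
    qed (auto simp: indicator_def)
  qed
  also have "(LINT t|lborel. LINT s|lborel. k s * k t * indicator {..t} s)
      = (LINT t|lborel. k t * (f t - f a))"
  proof (rule integral_cong_AE)
    show "AE t in lborel. (LINT s|lborel. k s * k t * indicator {..t} s) = k t * (f t - f a)"
      using k_supp
    proof eventually_elim
      case (elim t)
      have "(LINT s|lborel. k s * k t * indicator {..t} s) = k t * (LINT s|lborel. k s * indicator {..t} s)"
        by (subst integral_mult_right_zero[symmetric]) (simp add: mult_ac)
      thus ?case using elim lower[of t] by (cases "t \<in> {a<..b}") auto
    qed
    have "(\<lambda>t. LINT s|lborel. k s * k t * indicator {(s::real,t). s \<le> t} (s, t)) \<in> borel_measurable lborel"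
      by measurable
    thus "(\<lambda>t. LINT s|lborel. k s * k t * indicator {..t} s) \<in> borel_measurable lborel"
      by (rule back_subst) (auto simp: indicator_def fun_eq_iff)
  qed simp
  also have "(LINT s|lborel. LINT t|lborel. k s * k t * indicator {..t} s)
      = (LINT s|lborel. k s * (f b - f s))"
  proof (rule integral_cong_AE)
    show "AE s in lborel. (LINT t|lborel. k s * k t * indicator {..t} s) = k s * (f b - f s)"
      using k_supp
    proof eventually_elim
      case (elim s)
      have "(LINT t|lborel. k s * k t * indicator {..t} s) = k s * (LINT t|lborel. k t * indicator {s..} t)"
        by (subst integral_mult_right_zero[symmetric]) (simp add: mult_ac indicator_def)
      thus ?case using elim upper[of s] by (cases "s \<in> {a<..b}") auto
    qed
    have "(\<lambda>s. LINT t|lborel. k s * k t * indicator {(s::real,t). s \<le> t} (s, t)) \<in> borel_measurable lborel"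
      by measurable
    thus "(\<lambda>s. LINT t|lborel. k s * k t * indicator {..t} s) \<in> borel_measurable lborel"
      by (rule back_subst) (auto simp: indicator_def fun_eq_iff)
  qed simp
  finally have eq: "(LINT t|lborel. k t * (f t - f a)) = (LINT s|lborel. k s * (f b - f s))" .
  have kf: "integrable lborel (\<lambda>x. k x * f x)"
  proof -
    have "compact (f ` {a..b})"
      using c continuous_on_subset by (intro compact_continuous_image) auto
    then obtain B where B: "\<And>x. x \<in> {a..b} \<Longrightarrow> \<bar>f x\<bar> \<le> B"
      by (metis compact_imp_bounded bounded_iff image_eqI real_norm_def)
    show ?thesis
    proof (rule Bochner_Integration.integrable_bound)
      show "integrable lborel (\<lambda>x. k x * B)" using k(1) by simp
      show "AE x in lborel. norm (k x * f x) \<le> norm (k x * B)"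
        using k_supp
      proof eventually_elim
        case (elim x)
        show ?case
        proof (cases "x \<in> {a<..b}")
          case True
          hence "\<bar>f x\<bar> \<le> \<bar>B\<bar>" using B[of x] by auto
          thus ?thesis by (simp add: abs_mult mult_left_mono)
        qed (use elim in simp)
      qed
    qed simp
  qed
  have ka: "(LINT x|lborel. k x) = f b - f a"
    using conv[of "\<lambda>_. 1"] weak_deriv_FTC[OF w c ab] by simp
  have "(LINT t|lborel. k t * (f t - f a)) = (LINT t|lborel. k t * f t) - f a * (f b - f a)"
    using k(1) kf ka by (simp add: right_diff_distrib mult.commute)
  moreover have "(LINT t|lborel. k t * (f b - f t)) = f b * (f b - f a) - (LINT t|lborel. k t * f t)"
    using k(1) kf ka by (simp add: right_diff_distrib mult.commute)
  moreover have "(LINT t|lborel. k t * f t) = (LINT x|lebesgue. f' x * f x * indicator {a<..b} x)"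
    using conv[of f] by (simp add: mult_ac)
  ultimately show ?thesis using eq by (simp add: power2_eq_square algebra_simps)
qed

text \<open>Otherwise the square would be at least \<open>e\<close> on arbitrarily long intervals.\<close>

lemma L2_continuous_small_value:
  assumes "f \<in> L2_space" "continuous_on UNIV f" "e > 0"
  shows "\<exists>a<x. (f a)\<^sup>2 < e" "\<exists>b>x. (f b)\<^sup>2 < e"
proof -
  have i: "integrable lebesgue (\<lambda>y. (f y)\<^sup>2)" using assms(1) by (simp add: L2_space_def)
  have *: False if large: "\<And>n::nat. \<exists>u. \<forall>y\<in>{u<..<u + real n}. e \<le> (f y)\<^sup>2"
  proof -
    define A where "A = (LINT y|lebesgue. (f y)\<^sup>2)"
    obtain n :: nat where n: "A / e < real n" using reals_Archimedean2 by blast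
    obtain u where u: "\<And>y. y \<in> {u<..<u + real n} \<Longrightarrow> e \<le> (f y)\<^sup>2" using large by blast
    have "(LINT y|lebesgue. e * indicator {u<..<u+real n} y) \<le> A"
      unfolding A_def
    proof (rule integral_mono[OF _ i])
      show "integrable lebesgue (\<lambda>y. e * indicator {u<..<u+real n} y)"
        by (intro integrable_mult_right integrable_real_indicator) auto
      show "e * indicator {u<..<u+real n} y \<le> (f y)\<^sup>2" for y
        using u by (auto simp: indicator_def)
    qed
    moreover have "(LINT y|lebesgue. e * indicator {u<..<u+real n} y) = e * real n"
      by simp
    ultimately show False using n assms(3) by (simp add: field_simps)
  qed
  show "\<exists>a<x. (f a)\<^sup>2 < e"
  proof (rule ccontr)
    assume "\<not> (\<exists>a<x. (f a)\<^sup>2 < e)"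
    hence "e \<le> (f y)\<^sup>2" if "y < x" for y using that by (meson not_less)
    hence "\<forall>y\<in>{x - real n<..<x - real n + real n}. e \<le> (f y)\<^sup>2" for n by simp
    thus False using * by blast
  qed
  show "\<exists>a>x. (f a)\<^sup>2 < e"
  proof (rule ccontr)
    assume "\<not> (\<exists>a>x. (f a)\<^sup>2 < e)"
    hence "e \<le> (f y)\<^sup>2" if "x < y" for y using that by (meson not_less)
    hence "\<forall>y\<in>{x<..<x + real n}. e \<le> (f y)\<^sup>2" for n by simp
    thus False using * by blast
  qed
qed

text \<open>Reaching \<open>x\<close> from both sides, from points \<open>a < x < b\<close> where \<open>f\<close> is small, and adding the two identities
  for \<open>f\<^sup>2\<close> gives \<open>2 (f x)\<^sup>2\<close> on the left, while the integrals on the right extend over disjoint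
  intervals. The range ball \<open>I\<close> has the radius that goes with exactly this constant.\<close>

lemma Sobolev_inequality:
  assumes "f \<in> H1_space"
  shows "2 * (f x)\<^sup>2 \<le> (H1_norm f)\<^sup>2"
proof (rule field_le_epsilon)
  fix e :: real assume e: "0 < e"
  note f = H1_spaceD[OF assms]
  define f' where "f' = weak_deriv f"
  obtain a where a: "a < x" "(f a)\<^sup>2 < e / 2"
    using L2_continuous_small_value(1)[OF f(2,1), of "e/2" x] e by auto
  obtain b where b: "x < b" "(f b)\<^sup>2 < e / 2"
    using L2_continuous_small_value(2)[OF f(2,1), of "e/2" x] e by auto
  have i: "integrable lebesgue (\<lambda>y. f' y * f y)"
    using L2_mult_integrable[OF f(4,2)] by (simp add: f'_def)
  have ii: "integrable lebesgue (\<lambda>y. f' y * f y * indicator {u<..v} y)" for u v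
    using integrable_mult_indicator[OF _ i, of "{u<..v}"] by (simp add: mult.commute)
  have "2 * (f x)\<^sup>2 = (f a)\<^sup>2 + (f b)\<^sup>2 + 2 * (LINT y|lebesgue. f' y * f y * indicator {a<..x} y)
      - 2 * (LINT y|lebesgue. f' y * f y * indicator {x<..b} y)"
    using weak_deriv_square_FTC[OF f(3,1), of a x] weak_deriv_square_FTC[OF f(3,1), of x b] a b
    by (simp add: f'_def)
  also have "\<dots> = (f a)\<^sup>2 + (f b)\<^sup>2
      + (LINT y|lebesgue. 2 * (f' y * f y * indicator {a<..x} y - f' y * f y * indicator {x<..b} y))"
    using ii by simp
  also have "(LINT y|lebesgue. 2 * (f' y * f y * indicator {a<..x} y - f' y * f y * indicator {x<..b} y))
     \<le> (LINT y|lebesgue. (f y)\<^sup>2 + (f' y)\<^sup>2)"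
  proof (rule integral_mono)
    show "integrable lebesgue (\<lambda>y. (f y)\<^sup>2 + (f' y)\<^sup>2)"
      using f by (simp add: L2_space_def f'_def)
    fix y
    have "2 * \<bar>f' y * f y\<bar> \<le> (f y)\<^sup>2 + (f' y)\<^sup>2"
      using sum_squares_bound[of "\<bar>f y\<bar>" "\<bar>f' y\<bar>"] by (simp add: abs_mult mult_ac)
    thus "2 * (f' y * f y * indicator {a<..x} y - f' y * f y * indicator {x<..b} y) \<le> (f y)\<^sup>2 + (f' y)\<^sup>2"
      by (auto simp: indicator_def abs_le_iff)
  qed (use ii in simp)
  also have "(LINT y|lebesgue. (f y)\<^sup>2 + (f' y)\<^sup>2) = (H1_norm f)\<^sup>2"
    using f by (simp add: L2_space_def f'_def H1_norm_square L2_norm_square)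
  finally show "2 * (f x)\<^sup>2 \<le> (H1_norm f)\<^sup>2 + e" using a b by simp
qed

section \<open>Convolution with an integrable kernel\<close>

definition conv :: "(real \<Rightarrow> real) \<Rightarrow> (real \<Rightarrow> real) \<Rightarrow> real \<Rightarrow> real" where
  "conv K G x = (LINT y|lebesgue. K (x - y) * G y)"

lemma AE_lborel_reflect:
  assumes "AE y in lborel. P y"
  shows "AE y in lborel. P (x - y :: real)"
proof -
  obtain N where N: "N \<in> null_sets lborel" "{y. \<not> P y} \<subseteq> N"
    using assms unfolding eventually_ae_filter by auto
  have m: "Measurable.pred borel (\<lambda>y. y \<notin> N)" using N(1) by (auto simp: null_sets_def pred_def)
  have "AE y in lborel. x + (-1) * y \<notin> N"
    by (rule AE_borel_affine[OF _ m AE_not_in[OF N(1)]]) simp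
  thus ?thesis by eventually_elim (use N(2) in auto)
qed

text \<open>A Lebesgue measurable kernel does not make \<open>K (x - y)\<close> measurable for the product of two Lebesgue
  sigma-algebras, so arguments by Fubini go through a Borel version of the kernel.\<close>

lemma conv_borel_version:
  assumes k: "integrable lborel k" and ae: "AE x in lborel. K x = k x"
    and m: "K \<in> borel_measurable lebesgue" and G: "continuous_on UNIV G"
  shows "conv K G x = (LINT y|lborel. k (x - y) * G y)"
    and "conv K G x = (LINT t|lborel. k t * G (x - t))"
proof -
  note [measurable] = borel_measurable_integrable[OF k] borel_measurable_continuous_onI[OF G]
  show 1: "conv K G x = (LINT y|lborel. k (x - y) * G y)"
  proof -
    have "conv K G x = (LINT y|lebesgue. k (x - y) * G y)"
      unfolding conv_def
    proof (rule integral_cong_AE)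
      have "(\<lambda>y. x - y) \<in> lebesgue \<rightarrow>\<^sub>M lebesgue"
        using lebesgue_affine_measurable[where c= "\<lambda>x::real. -1" and t=x] by simp
      hence [measurable]: "(\<lambda>y. K (x - y)) \<in> borel_measurable lebesgue"
        using m by (rule measurable_compose)
      have [measurable]: "G \<in> borel_measurable lebesgue" using G by (rule continuous_lebesgue_measurable)
      show "(\<lambda>y. K (x - y) * G y) \<in> borel_measurable lebesgue" by measurable
      show "(\<lambda>y. k (x - y) * G y) \<in> borel_measurable lebesgue"
        by (rule measurable_completion) simp
      show "AE y in lebesgue. K (x - y) * G y = k (x - y) * G y"
        using AE_completion[OF AE_lborel_reflect[OF ae, of x]] by eventually_elim simp
    qed
    also have "\<dots> = (LINT y|lborel. k (x - y) * G y)"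
      by (rule integral_completion) simp
    finally show ?thesis .
  qed
  also have "\<dots> = \<bar>-1\<bar> *\<^sub>R (LINT t|lborel. k (x - (x + (-1) * t)) * G (x + (-1) * t))"
    by (rule lborel_integral_real_affine) simp
  finally show "conv K G x = (LINT t|lborel. k t * G (x - t))" by simp
qed

lemma integrable_mult_bounded_continuous:
  fixes k G :: "real \<Rightarrow> real"
  assumes "integrable lborel k" "continuous_on UNIV G" "\<And>x. \<bar>G x\<bar> \<le> B"
  shows "integrable lborel (\<lambda>t. k t * G (x - t))" "integrable lborel (\<lambda>t. k (x - t) * G t)"
proof -
  note [measurable] = borel_measurable_integrable[OF assms(1)] borel_measurable_continuous_onI[OF assms(2)]
  show 1: "integrable lborel (\<lambda>t. k t * G (x - t))"
  proof (rule Bochner_Integration.integrable_bound)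
    show "integrable lborel (\<lambda>t. k t * B)" using assms(1) by simp
    show "AE t in lborel. norm (k t * G (x - t)) \<le> norm (k t * B)"
    proof (intro AE_I2)
      fix t
      have "\<bar>G (x - t)\<bar> \<le> \<bar>B\<bar>" using assms(3)[of "x - t"] by linarith
      thus "norm (k t * G (x - t)) \<le> norm (k t * B)" by (simp add: abs_mult mult_left_mono)
    qed
  qed simp
  from lborel_integrable_real_affine[OF this, of "-1" x]
  show "integrable lborel (\<lambda>t. k (x - t) * G t)" by simp
qed

lemma conv_continuous:
  assumes k: "integrable lborel k" and ae: "AE x in lborel. K x = k x"
    and m: "K \<in> borel_measurable lebesgue" and G: "continuous_on UNIV G" and B: "\<And>x. \<bar>G x\<bar> \<le> B"
  shows "continuous_on UNIV (conv K G)"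
proof -
  note [measurable] = borel_measurable_integrable[OF k] borel_measurable_continuous_onI[OF G]
  have "isCont (conv K G) a" for a
  proof (rule continuous_at_sequentiallyI)
    fix u assume u: "u \<longlonglongrightarrow> a"
    have "(\<lambda>n. LINT t|lborel. k t * G (u n - t)) \<longlonglongrightarrow> (LINT t|lborel. k t * G (a - t))"
    proof (rule integral_dominated_convergence[where w="\<lambda>t. \<bar>k t\<bar> * B"])
      show "integrable lborel (\<lambda>t. \<bar>k t\<bar> * B)" using k by simp
      show "AE t in lborel. (\<lambda>n. k t * G (u n - t)) \<longlonglongrightarrow> k t * G (a - t)"
      proof (intro AE_I2 tendsto_mult_left)
        fix t
        have "(\<lambda>n. u n - t) \<longlonglongrightarrow> a - t" by (intro tendsto_intros u)
        thus "(\<lambda>n. G (u n - t)) \<longlonglongrightarrow> G (a - t)"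
          using G by (intro isCont_tendsto_compose[of "a - t" G])
            (auto simp: continuous_on_eq_continuous_at)
      qed
      show "AE t in lborel. norm (k t * G (u n - t)) \<le> \<bar>k t\<bar> * B" for n
        using B by (intro AE_I2) (simp add: abs_mult mult_left_mono)
    qed measurable
    thus "(\<lambda>n. conv K G (u n)) \<longlonglongrightarrow> conv K G a"
      by (simp add: conv_borel_version(2)[OF k ae m G])
  qed
  thus ?thesis by (simp add: continuous_at_imp_continuous_on)
qed

text \<open>Splitting \<open>\<bar>k\<bar> \<bar>G\<bar>\<close> as \<open>sqrt \<bar>k\<bar> \<cdot> (sqrt \<bar>k\<bar> \<bar>G\<bar>)\<close> in the Cauchy-Schwarz inequality bounds the square of
  the convolution by \<open>\<parallel>K\<parallel>\<close> times the convolution of \<open>\<bar>k\<bar>\<close> with \<open>G\<^sup>2\<close>, whose total integral is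
  computed by Tonelli.\<close>

lemma Young_L2:
  assumes K: "integrable lebesgue K" and G: "continuous_on UNIV G" and B: "\<And>x. \<bar>G x\<bar> \<le> B"
    and G2: "G \<in> L2_space"
  shows "conv K G \<in> L2_space" "L2_norm (conv K G) \<le> L1_norm K * L2_norm G"
proof -
  obtain k where k: "integrable lborel k" "AE x in lebesgue. K x = k x" "AE x in lborel. K x = k x"
    using integrable_lebesgue_borel_version[OF K] .
  note m = borel_measurable_integrable[OF K]
  note C = conv_continuous[OF k(1,3) m G B]
  note [measurable] = borel_measurable_integrable[OF k(1)] borel_measurable_continuous_onI[OF G]
    borel_measurable_continuous_onI[OF C]
  define A where "A = (LINT t|lborel. \<bar>k t\<bar>)"
  have A: "L1_norm K = A"
  proof -
    have "(LINT x|lborel. \<bar>k x\<bar> * 1) = (LINT x|lebesgue. \<bar>K x\<bar> * 1)"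
      by (rule integral_borel_version) (use k m in \<open>auto elim: eventually_mono\<close>)
    thus ?thesis by (simp add: A_def L1_norm_def)
  qed
  have A0: "0 \<le> A" by (simp add: A_def)
  have An: "(\<integral>\<^sup>+t. ennreal \<bar>k t\<bar> \<partial>lborel) = ennreal A"
    unfolding A_def using k(1) by (intro nn_integral_eq_integral) auto
  define S where "S = (LINT t|lborel. (G t)\<^sup>2)"
  have Gi: "integrable lborel (\<lambda>t. (G t)\<^sup>2)"
    using G2 integrable_completion[of "\<lambda>t. (G t)\<^sup>2" lborel] by (simp add: L2_space_def)
  have S: "(L2_norm G)\<^sup>2 = S"
    unfolding L2_norm_square S_def by (rule integral_completion) simp
  have S0: "0 \<le> S" by (simp add: S_def)
  have Sn: "(\<integral>\<^sup>+t. ennreal ((G t)\<^sup>2) \<partial>lborel) = ennreal S"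
    unfolding S_def using Gi by (intro nn_integral_eq_integral) auto
  have pt: "ennreal ((conv K G x)\<^sup>2) \<le> ennreal A * (\<integral>\<^sup>+t. ennreal \<bar>k t\<bar> * ennreal ((G (x - t))\<^sup>2) \<partial>lborel)" for x
  proof -
    have i: "integrable lborel (\<lambda>t. k t * G (x - t))"
      by (rule integrable_mult_bounded_continuous[OF k(1) G B])
    have "\<bar>conv K G x\<bar> \<le> (LINT t|lborel. \<bar>k t * G (x - t)\<bar>)"
      unfolding conv_borel_version(2)[OF k(1,3) m G] by (rule integral_abs_bound)
    hence "ennreal \<bar>conv K G x\<bar> \<le> ennreal (LINT t|lborel. \<bar>k t * G (x - t)\<bar>)"
      by (rule ennreal_leI)
    also have "\<dots> = (\<integral>\<^sup>+t. ennreal \<bar>k t * G (x - t)\<bar> \<partial>lborel)"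
      using i by (intro nn_integral_eq_integral[symmetric]) auto
    also have "\<dots> = (\<integral>\<^sup>+t. ennreal (sqrt \<bar>k t\<bar>) * ennreal (sqrt \<bar>k t\<bar> * \<bar>G (x - t)\<bar>) \<partial>lborel)"
      by (intro nn_integral_cong)
        (simp add: ennreal_mult'[symmetric] mult.assoc[symmetric] abs_mult)
    finally have "(ennreal \<bar>conv K G x\<bar>)\<^sup>2 \<le> (\<integral>\<^sup>+t. ennreal (sqrt \<bar>k t\<bar>) * ennreal (sqrt \<bar>k t\<bar> * \<bar>G (x - t)\<bar>) \<partial>lborel)\<^sup>2"
      by (rule power_mono) simp
    also have "\<dots> \<le> (\<integral>\<^sup>+t. (ennreal (sqrt \<bar>k t\<bar>))\<^sup>2 \<partial>lborel) *
                      (\<integral>\<^sup>+t. (ennreal (sqrt \<bar>k t\<bar> * \<bar>G (x - t)\<bar>))\<^sup>2 \<partial>lborel)"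
      by (rule Cauchy_Schwarz_nn_integral) measurable
    also have "(\<integral>\<^sup>+t. (ennreal (sqrt \<bar>k t\<bar>))\<^sup>2 \<partial>lborel) = ennreal A"
      unfolding An[symmetric] by (simp add: ennreal_power)
    also have "(\<integral>\<^sup>+t. (ennreal (sqrt \<bar>k t\<bar> * \<bar>G (x - t)\<bar>))\<^sup>2 \<partial>lborel)
        = (\<integral>\<^sup>+t. ennreal \<bar>k t\<bar> * ennreal ((G (x - t))\<^sup>2) \<partial>lborel)"
      by (intro nn_integral_cong) (simp add: ennreal_power power_mult_distrib ennreal_mult)
    finally show ?thesis by (simp add: ennreal_power)
  qed
  have "(\<integral>\<^sup>+x. ennreal ((conv K G x)\<^sup>2) \<partial>lborel) \<le>
        (\<integral>\<^sup>+x. ennreal A * (\<integral>\<^sup>+t. ennreal \<bar>k t\<bar> * ennreal ((G (x - t))\<^sup>2) \<partial>lborel) \<partial>lborel)"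
    by (rule nn_integral_mono) (rule pt)
  also have "\<dots> = ennreal A * (\<integral>\<^sup>+x. (\<integral>\<^sup>+t. ennreal \<bar>k t\<bar> * ennreal ((G (x - t))\<^sup>2) \<partial>lborel) \<partial>lborel)"
    by (rule nn_integral_cmult) measurable
  also have "(\<integral>\<^sup>+x. (\<integral>\<^sup>+t. ennreal \<bar>k t\<bar> * ennreal ((G (x - t))\<^sup>2) \<partial>lborel) \<partial>lborel)
      = (\<integral>\<^sup>+t. (\<integral>\<^sup>+x. ennreal \<bar>k t\<bar> * ennreal ((G (x - t))\<^sup>2) \<partial>lborel) \<partial>lborel)"
    by (rule lborel_pair.Fubini') measurable
  also have "\<dots> = (\<integral>\<^sup>+t. ennreal \<bar>k t\<bar> * ennreal S \<partial>lborel)"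
  proof (rule nn_integral_cong)
    fix t
    have "(\<integral>\<^sup>+x. ennreal \<bar>k t\<bar> * ennreal ((G (x - t))\<^sup>2) \<partial>lborel) =
      ennreal \<bar>k t\<bar> * (\<integral>\<^sup>+x. ennreal ((G (x - t))\<^sup>2) \<partial>lborel)"
      by (rule nn_integral_cmult) measurable
    also have "(\<integral>\<^sup>+x. ennreal ((G (x - t))\<^sup>2) \<partial>lborel) = ennreal S"
      unfolding Sn[symmetric]
      using nn_integral_real_affine[of "\<lambda>x. ennreal ((G x)\<^sup>2)" 1 "-t"] by simp
    finally show "(\<integral>\<^sup>+x. ennreal \<bar>k t\<bar> * ennreal ((G (x - t))\<^sup>2) \<partial>lborel) = ennreal \<bar>k t\<bar> * ennreal S" .
  qed
  also have "\<dots> = ennreal A * ennreal S"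
    by (subst nn_integral_multc) (simp_all add: An)
  also have "ennreal A * (ennreal A * ennreal S) = ennreal (A\<^sup>2 * S)"
    using A0 S0 by (simp add: ennreal_mult power2_eq_square mult.assoc)
  finally have le: "(\<integral>\<^sup>+x. ennreal ((conv K G x)\<^sup>2) \<partial>lborel) \<le> ennreal (A\<^sup>2 * S)" .
  hence i: "integrable lborel (\<lambda>x. (conv K G x)\<^sup>2)"
    by (intro integrableI_bounded) (auto simp: less_top[symmetric] top_unique)
  hence "integrable lebesgue (\<lambda>x. (conv K G x)\<^sup>2)"
    using integrable_completion[of "\<lambda>t. (conv K G t)\<^sup>2" lborel] by simp
  thus "conv K G \<in> L2_space" using continuous_lebesgue_measurable[OF C] by (simp add: L2_space_def)
  have "ennreal (LINT x|lborel. (conv K G x)\<^sup>2) = (\<integral>\<^sup>+x. ennreal ((conv K G x)\<^sup>2) \<partial>lborel)"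
    using i by (intro nn_integral_eq_integral[symmetric]) auto
  hence "ennreal (LINT x|lborel. (conv K G x)\<^sup>2) \<le> ennreal (A\<^sup>2 * S)"
    using le by simp
  hence "(LINT x|lborel. (conv K G x)\<^sup>2) \<le> A\<^sup>2 * S"
    by (rule ennreal_le_iff[THEN iffD1, rotated]) (use S0 in simp)
  moreover have "(LINT x|lborel. (conv K G x)\<^sup>2) = (L2_norm (conv K G))\<^sup>2"
    unfolding L2_norm_square by (rule integral_completion[symmetric]) simp
  ultimately have "(L2_norm (conv K G))\<^sup>2 \<le> (A * L2_norm G)\<^sup>2"
    by (simp add: power_mult_distrib S)
  thus "L2_norm (conv K G) \<le> L1_norm K * L2_norm G"
    unfolding A by (rule power2_le_imp_le) (simp add: A0)
qed

text \<open>This moves the pairing with a test function onto the kernel, where the weak derivative acts on a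
  translated test function.\<close>

lemma conv_pairing:
  assumes K: "integrable lebesgue K" and G: "continuous_on UNIV G" and B: "\<And>x. \<bar>G x\<bar> \<le> B"
    and \<phi>: "continuous_on UNIV \<phi>" and supp: "\<And>x. r < \<bar>x\<bar> \<Longrightarrow> \<phi> x = 0"
  shows "(LINT x|lebesgue. conv K G x * \<phi> x) = (LINT y|lborel. G y * (LINT t|lebesgue. K t * \<phi> (t + y)))"
proof -
  obtain k where k: "integrable lborel k" "AE x in lebesgue. K x = k x" "AE x in lborel. K x = k x"
    using integrable_lebesgue_borel_version[OF K] .
  note m = borel_measurable_integrable[OF K]
  note C = conv_continuous[OF k(1,3) m G B]
  note [measurable] = borel_measurable_integrable[OF k(1)] borel_measurable_continuous_onI[OF G]
    borel_measurable_continuous_onI[OF C] borel_measurable_continuous_onI[OF \<phi>]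
  have B0: "0 \<le> B" using B[of 0] by linarith
  have "integrable lebesgue (\<lambda>x. 1 * \<phi> x)"
    by (rule integrable_mult_compact_support[OF continuous_locally_integrable \<phi> supp]) auto
  hence \<phi>i: "integrable lborel \<phi>" using integrable_completion[of \<phi> lborel] by simp
  have ki: "integrable lborel (\<lambda>y. k (x - y))" for x
    using lborel_integrable_real_affine[OF k(1), of "-1" x] by simp
  have kn: "(LINT y|lborel. \<bar>k (x - y)\<bar>) = (LINT y|lborel. \<bar>k y\<bar>)" for x
    using lborel_integral_real_affine[of "-1" "\<lambda>y. \<bar>k y\<bar>" x] by simp
  have k\<phi>: "integrable (lborel \<Otimes>\<^sub>M lborel) (\<lambda>(x, y). k (x - y) * \<phi> x * B)"
  proof (rule lborel_pair.Fubini_integrable)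
    show "integrable lborel (\<lambda>x. LINT y|lborel. norm (case (x, y) of (x, y) \<Rightarrow> k (x - y) * \<phi> x * B))"
      using \<phi>i by (simp add: abs_mult kn)
    show "AE x in lborel. integrable lborel (\<lambda>y. case (x, y) of (x, y) \<Rightarrow> k (x - y) * \<phi> x * B)"
      using ki by simp
  qed measurable
  have "(LINT x|lebesgue. conv K G x * \<phi> x) = (LINT x|lborel. conv K G x * \<phi> x)"
    by (rule integral_completion) simp
  also have "\<dots> = (LINT x|lborel. LINT y|lborel. k (x - y) * \<phi> x * G y)"
  proof (rule Bochner_Integration.integral_cong[OF refl])
    fix x
    have "conv K G x * \<phi> x = (LINT y|lborel. k (x - y) * G y * \<phi> x)"
      unfolding conv_borel_version(1)[OF k(1,3) m G] by simp
    thus "conv K G x * \<phi> x = (LINT y|lborel. k (x - y) * \<phi> x * G y)" by (simp add: mult_ac)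
  qed
  also have "\<dots> = (LINT y|lborel. LINT x|lborel. k (x - y) * \<phi> x * G y)"
  proof (rule lborel_pair.Fubini_integral[symmetric])
    show "integrable (lborel \<Otimes>\<^sub>M lborel) (\<lambda>(x, y). k (x - y) * \<phi> x * G y)"
    proof (rule Bochner_Integration.integrable_bound[OF k\<phi>])
      show "AE p in lborel \<Otimes>\<^sub>M lborel. norm (case p of (x, y) \<Rightarrow> k (x - y) * \<phi> x * G y)
              \<le> norm (case p of (x, y) \<Rightarrow> k (x - y) * \<phi> x * B)"
        using B B0 by (intro AE_I2) (auto simp: abs_mult intro!: mult_left_mono)
    qed measurable
  qed
  also have "\<dots> = (LINT y|lborel. G y * (LINT t|lebesgue. K t * \<phi> (t + y)))"
  proof (rule Bochner_Integration.integral_cong[OF refl])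
    fix y
    have "(LINT x|lborel. k (x - y) * \<phi> x * G y) = (LINT x|lborel. k (x - y) * \<phi> x) * G y"
      by simp
    also have "(LINT x|lborel. k (x - y) * \<phi> x) = (LINT t|lborel. k t * \<phi> (t + y))"
      using lborel_integral_real_affine[of 1 "\<lambda>x. k (x - y) * \<phi> x" y] by (simp add: add.commute)
    also have "\<dots> = (LINT t|lebesgue. K t * \<phi> (t + y))"
      by (rule integral_borel_version[OF k(1) m k(2)]) measurable
    finally show "(LINT x|lborel. k (x - y) * \<phi> x * G y) = G y * (LINT t|lebesgue. K t * \<phi> (t + y))"
      by (simp add: mult.commute)
  qed
  finally show ?thesis .
qed

lemma W11_spaceD:
  assumes "K \<in> W11_space"
  shows "integrable lebesgue K" "has_weak_deriv K (weak_deriv K)" "integrable lebesgue (weak_deriv K)"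
proof -
  show "integrable lebesgue K" using assms by (simp add: W11_space_def)
  obtain K' where K': "has_weak_deriv K K'" "integrable lebesgue K'" using assms by (auto simp: W11_space_def)
  show w: "has_weak_deriv K (weak_deriv K)" by (rule has_weak_deriv_weak_deriv[OF K'(1)])
  have "weak_deriv K \<in> borel_measurable lebesgue"
    using w locally_integrable_measurable by (simp add: has_weak_deriv_def)
  thus "integrable lebesgue (weak_deriv K)"
    using integrable_cong_AE[OF _ _ weak_deriv_AE_eq[OF K'(1)]] K'(2) by auto
qed

text \<open>The weak derivative of \<open>K * G\<close> is \<open>K' * G\<close>, with the derivative on the kernel, so Young's inequality
  applies to both and the \<open>W\<^sup>1\<^sup>,\<^sup>1\<close> norm of \<open>K\<close> is the sum of the two constants.\<close>

lemma conv_H1: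
  assumes K: "K \<in> W11_space" and G: "continuous_on UNIV G" and B: "\<And>x. \<bar>G x\<bar> \<le> B"
    and G2: "G \<in> L2_space"
  shows "conv K G \<in> H1_space" "H1_norm (conv K G) \<le> W11_norm K * L2_norm G"
proof -
  note KD = W11_spaceD[OF K]
  define K' where "K' = weak_deriv K"
  have c: "continuous_on UNIV (conv L G)" if L: "integrable lebesgue L" for L
  proof -
    obtain k where k: "integrable lborel k" "AE x in lborel. L x = k x"
      using integrable_lebesgue_borel_version[OF L] by metis
    show ?thesis by (rule conv_continuous[OF k borel_measurable_integrable[OF L] G B])
  qed
  have w: "has_weak_deriv (conv K G) (conv K' G)"
    unfolding has_weak_deriv_def
  proof (intro conjI allI impI)
    show "locally_integrable (conv K G)" "locally_integrable (conv K' G)"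
      using c KD by (auto intro!: continuous_locally_integrable simp: K'_def)
    fix \<eta> assume t: "test_function \<eta>"
    obtain r where r: "\<And>x. r < \<bar>x\<bar> \<Longrightarrow> \<eta> x = 0" "\<And>x. r < \<bar>x\<bar> \<Longrightarrow> deriv \<eta> x = 0"
      using test_function_deriv(4)[OF t] by blast
    have "(LINT x|lebesgue. conv K G x * deriv \<eta> x)
        = (LINT y|lborel. G y * (LINT t|lebesgue. K t * deriv \<eta> (t + y)))"
      by (rule conv_pairing[OF KD(1) G B test_function_deriv(3)[OF t] r(2)])
    also have "\<dots> = (LINT y|lborel. - (G y * (LINT t|lebesgue. K' t * \<eta> (t + y))))"
    proof (rule Bochner_Integration.integral_cong[OF refl])
      fix y
      have "deriv (\<lambda>t. \<eta> (t + y)) = (\<lambda>t. deriv \<eta> (t + y))"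
        by (intro ext DERIV_imp_deriv DERIV_shift[THEN iffD1] test_function_deriv(1)[OF t])
      hence "(LINT t|lebesgue. K t * deriv \<eta> (t + y)) = - (LINT t|lebesgue. K' t * \<eta> (t + y))"
        using KD(2) test_function_translate[OF t, of y] unfolding has_weak_deriv_def K'_def by metis
      thus "G y * (LINT t|lebesgue. K t * deriv \<eta> (t + y)) = - (G y * (LINT t|lebesgue. K' t * \<eta> (t + y)))"
        by simp
    qed
    also have "\<dots> = - (LINT y|lborel. G y * (LINT t|lebesgue. K' t * \<eta> (t + y)))" by simp
    also have "(LINT y|lborel. G y * (LINT t|lebesgue. K' t * \<eta> (t + y))) = (LINT x|lebesgue. conv K' G x * \<eta> x)"
      unfolding K'_def
      by (rule conv_pairing[OF KD(3) G B test_function_deriv(2)[OF t] r(1), symmetric])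
    finally show "(LINT x|lebesgue. conv K G x * deriv \<eta> x) = - (LINT x|lebesgue. conv K' G x * \<eta> x)" .
  qed
  note Y = Young_L2[OF KD(1) G B G2] and Y' = Young_L2[OF KD(3) G B G2, folded K'_def]
  show "conv K G \<in> H1_space"
    unfolding H1_space_def using c[OF KD(1)] Y(1) w Y'(1) by blast
  have L1: "0 \<le> L1_norm f" for f by (simp add: L1_norm_def)
  have "H1_norm (conv K G) = sqrt ((L2_norm (conv K G))\<^sup>2 + (L2_norm (conv K' G))\<^sup>2)"
    unfolding H1_norm_def L2_norm_weak_deriv[OF w Y'(1)] ..
  also have "\<dots> \<le> L2_norm (conv K G) + L2_norm (conv K' G)"
    by (rule sqrt_sum_squares_le_sum) simp_all
  also have "\<dots> \<le> L1_norm K * L2_norm G + L1_norm K' * L2_norm G"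
    using Y(2) Y'(2) by (rule add_mono)
  also have "\<dots> = W11_norm K * L2_norm G" by (simp add: W11_norm_def K'_def distrib_right)
  finally show "H1_norm (conv K G) \<le> W11_norm K * L2_norm G" .
qed

lemma conv_diff:
  assumes K: "integrable lebesgue K" and G: "continuous_on UNIV G" "\<And>x. \<bar>G x\<bar> \<le> B"
    and H: "continuous_on UNIV H" "\<And>x. \<bar>H x\<bar> \<le> B'"
  shows "conv K (\<lambda>y. G y - H y) x = conv K G x - conv K H x"
proof -
  obtain k where k: "integrable lborel k" "AE x in lborel. K x = k x"
    using integrable_lebesgue_borel_version[OF K] by metis
  note m = borel_measurable_integrable[OF K]
  have "continuous_on UNIV (\<lambda>y. G y - H y)" using G H by (intro continuous_intros)
  thus ?thesis
    using integrable_mult_bounded_continuous(1)[OF k(1) G, of x]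
      integrable_mult_bounded_continuous(1)[OF k(1) H, of x]
    by (simp add: conv_borel_version(2)[OF k m] G(1) H(1) right_diff_distrib)
qed

section \<open>Vector-valued Sobolev functions\<close>

lemma H1vec_norm_eq_L2_set: "H1vec_norm u = L2_set (\<lambda>m. H1_norm (\<lambda>x. u x $ m)) UNIV"
  by (simp add: H1vec_norm_def L2_set_def H1_norm_square sum.distrib)

lemma H1vec_norm_nonneg [simp]: "0 \<le> H1vec_norm u"
  by (simp add: H1vec_norm_eq_L2_set L2_set_nonneg)

lemma H1_norm_component_le: "H1_norm (\<lambda>x. u x $ m) \<le> H1vec_norm u"
  unfolding H1vec_norm_eq_L2_set by (rule member_le_L2_set) auto

lemma H1vec_add:
  assumes "u \<in> H1vec_space" "v \<in> H1vec_space"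
  shows "(\<lambda>x. u x + v x) \<in> H1vec_space" "H1vec_norm (\<lambda>x. u x + v x) \<le> H1vec_norm u + H1vec_norm v"
proof -
  have m: "(\<lambda>x. u x $ m) \<in> H1_space" "(\<lambda>x. v x $ m) \<in> H1_space" for m
    using assms by (auto simp: H1vec_space_def)
  note L = H1_lincomb[OF m, of 1 _ 1, simplified]
  show "(\<lambda>x. u x + v x) \<in> H1vec_space" using L(1) by (simp add: H1vec_space_def)
  have "H1vec_norm (\<lambda>x. u x + v x) \<le> L2_set (\<lambda>m. H1_norm (\<lambda>x. u x $ m) + H1_norm (\<lambda>x. v x $ m)) UNIV"
    unfolding H1vec_norm_eq_L2_set using L(2) by (intro L2_set_mono) auto
  also have "\<dots> \<le> H1vec_norm u + H1vec_norm v"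
    unfolding H1vec_norm_eq_L2_set by (rule L2_set_triangle_ineq)
  finally show "H1vec_norm (\<lambda>x. u x + v x) \<le> H1vec_norm u + H1vec_norm v" .
qed

lemma norm_vec_square: "(norm (z :: real ^ 'n))\<^sup>2 = (\<Sum>m\<in>UNIV. (z $ m)\<^sup>2)"
  by (simp add: norm_vec_def L2_set_def sum_nonneg)

lemma H1vec_Sobolev:
  fixes u :: "real \<Rightarrow> real ^ 'n"
  assumes "u \<in> H1vec_space"
  shows "norm (u x) \<le> 1 / sqrt 2 * H1vec_norm u"
proof -
  have "(norm (u x))\<^sup>2 = (\<Sum>m\<in>UNIV. (u x $ m)\<^sup>2)" by (rule norm_vec_square)
  also have "\<dots> \<le> (\<Sum>m\<in>UNIV. (H1_norm (\<lambda>x. u x $ m))\<^sup>2 / 2)"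
  proof (rule sum_mono)
    fix m
    show "(u x $ m)\<^sup>2 \<le> (H1_norm (\<lambda>x. u x $ m))\<^sup>2 / 2"
      using Sobolev_inequality[of "\<lambda>x. u x $ m" x] assms by (simp add: H1vec_space_def)
  qed
  also have "\<dots> = (1 / sqrt 2 * H1vec_norm u)\<^sup>2"
    by (simp add: H1vec_norm_eq_L2_set L2_set_def sum_nonneg power_mult_distrib power_divide sum_divide_distrib)
  finally show ?thesis by (rule power2_le_imp_le) simp
qed

lemma H1vec_L2:
  fixes u :: "real \<Rightarrow> real ^ 'n"
  assumes "u \<in> H1vec_space"
  shows "continuous_on UNIV u" "(\<lambda>x. norm (u x)) \<in> L2_space" "L2_norm (\<lambda>x. norm (u x)) \<le> H1vec_norm u"
proof -
  have m: "(\<lambda>x. u x $ m) \<in> H1_space" for m using assms by (simp add: H1vec_space_def)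
  note D = H1_spaceD[OF m]
  have "continuous_on UNIV (\<lambda>x. \<chi> m. u x $ m)"
    using D(1) by (intro continuous_on_vec_lambda)
  thus c: "continuous_on UNIV u" by simp
  have i: "integrable lebesgue (\<lambda>x. (u x $ m)\<^sup>2)" for m
    using D(2) by (simp add: L2_space_def)
  have "(\<lambda>x. norm (u x)) \<in> borel_measurable lebesgue"
    by (intro continuous_lebesgue_measurable continuous_intros c)
  thus "(\<lambda>x. norm (u x)) \<in> L2_space"
    using i by (simp add: L2_space_def norm_vec_square)
  have "(L2_norm (\<lambda>x. norm (u x)))\<^sup>2 = (\<Sum>m\<in>UNIV. (L2_norm (\<lambda>x. u x $ m))\<^sup>2)"
    using i by (simp add: L2_norm_square norm_vec_square)
  also have "\<dots> \<le> (\<Sum>m\<in>UNIV. (H1_norm (\<lambda>x. u x $ m))\<^sup>2)"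
    by (intro sum_mono power_mono L2_norm_le_H1_norm) simp
  also have "\<dots> = (H1vec_norm u)\<^sup>2"
    by (simp add: H1vec_norm_eq_L2_set L2_set_def sum_nonneg)
  finally show "L2_norm (\<lambda>x. norm (u x)) \<le> H1vec_norm u" by (rule power2_le_imp_le) simp
qed

section \<open>Bounded operators\<close>

text \<open>The functions of norm zero need the boundedness assumption itself: there the quotient in the
  supremum is zero by convention and says nothing about the image.\<close>

lemma onorm_H1_bound:
  assumes "bounded_linear_H1 T" "f \<in> H1_space"
  shows "H1_norm (T f) \<le> onorm_H1 T * H1_norm f"
proof -
  obtain C where C: "\<And>h. h \<in> H1_space \<Longrightarrow> H1_norm (T h) \<le> C * H1_norm h"
    using assms(1) unfolding bounded_linear_H1_def by blast
  show ?thesis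
  proof (cases "H1_norm f = 0")
    case True
    thus ?thesis using C[OF assms(2)] by simp
  next
    case False
    hence p: "0 < H1_norm f" using H1_norm_nonneg[of f] by linarith
    have "bdd_above ((\<lambda>f. H1_norm (T f) / H1_norm f) ` H1_space)"
    proof (rule bdd_aboveI2)
      fix h assume h: "h \<in> H1_space"
      have "H1_norm (T h) \<le> \<bar>C\<bar> * H1_norm h"
        using C[OF h] mult_right_mono[OF abs_ge_self[of C] H1_norm_nonneg[of h]] by linarith
      thus "H1_norm (T h) / H1_norm h \<le> \<bar>C\<bar>"
        by (cases "H1_norm h = 0") (simp_all add: pos_divide_le_eq order_less_le)
    qed
    hence "H1_norm (T f) / H1_norm f \<le> onorm_H1 T"
      unfolding onorm_H1_def by (rule cSUP_upper[OF assms(2)])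
    thus ?thesis using p by (simp add: pos_divide_le_eq)
  qed
qed

lemma bounded_linear_H1_diff:
  assumes "bounded_linear_H1 T" "f \<in> H1_space" "h \<in> H1_space"
  shows "T (\<lambda>x. f x - h x) = (\<lambda>x. T f x - T h x)"
proof -
  have mh: "(\<lambda>x. (-1) * h x) \<in> H1_space" using H1_lincomb(1)[OF assms(3,3), of "-1" 0] by simp
  have "T (\<lambda>x. f x + (-1) * h x) = (\<lambda>x. T f x + T (\<lambda>x. (-1) * h x) x)"
  proof -
    have "\<forall>f\<in>H1_space. \<forall>h\<in>H1_space. T (\<lambda>x. f x + h x) = (\<lambda>x. T f x + T h x)"
      using assms(1) by (simp add: bounded_linear_H1_def)
    from bspec[OF bspec[OF this assms(2)] mh] show ?thesis .
  qed
  also have "T (\<lambda>x. (-1) * h x) = (\<lambda>x. (-1) * T h x)"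
  proof -
    have "\<forall>c. \<forall>f\<in>H1_space. T (\<lambda>x. c * f x) = (\<lambda>x. c * T f x)"
      using assms(1) by (simp add: bounded_linear_H1_def)
    from bspec[OF spec[OF this] assms(3)] show ?thesis .
  qed
  finally show ?thesis by simp
qed

section \<open>Continuously differentiable functions on a ball\<close>

text \<open>At a boundary point a tangential axis direction leaves the ball at once, so uniqueness cannot be
  tested along the axes. Instead the two derivatives agree along all segments from \<open>z\<close> to points of
  the ball, and these directions determine a linear map.\<close>

lemma has_derivative_within_cball_unique:
  fixes h :: "'a :: euclidean_space \<Rightarrow> real"
  assumes r: "0 < r" and z: "z \<in> cball 0 r"
    and D1: "(h has_derivative D1) (at z within cball 0 r)"
    and D2: "(h has_derivative D2) (at z within cball 0 r)"
  shows "D1 = D2"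
proof -
  have l: "linear D1" "linear D2" using D1 D2 by (auto dest: has_derivative_linear)
  have *: "D1 (y - z) = D2 (y - z)" if y: "y \<in> cball 0 r" for y
  proof -
    define c where "c t = z + t *\<^sub>R (y - z)" for t :: real
    have sub: "c ` {0..1} \<subseteq> cball 0 r"
    proof
      fix w assume "w \<in> c ` {0..1}"
      then obtain t where t: "t \<in> {0..1}" "w = (1 - t) *\<^sub>R z + t *\<^sub>R y"
        by (auto simp: c_def algebra_simps)
      thus "w \<in> cball 0 r" using convexD[OF convex_cball z y, of "1 - t" t] by simp
    qed
    have c: "(c has_derivative (\<lambda>t. t *\<^sub>R (y - z))) (at 0 within {0..1})"
      unfolding c_def[abs_def] by (auto intro!: derivative_eq_intros)
    have V: "((h \<circ> c) has_vector_derivative D (y - z)) (at 0 within {0..1})"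
      if D: "(h has_derivative D) (at z within cball 0 r)" for D
    proof -
      have "(h has_derivative D) (at (c 0) within c ` {0..1})"
        using has_derivative_subset[OF D sub] by (simp add: c_def)
      from diff_chain_within[OF c this]
      have "((h \<circ> c) has_derivative (D \<circ> (\<lambda>t. t *\<^sub>R (y - z)))) (at 0 within {0..1})" .
      moreover have "linear D" using D by (rule has_derivative_linear)
      ultimately show ?thesis
        by (simp add: has_vector_derivative_def o_def linear_cmul)
    qed
    show ?thesis
    proof (rule vector_derivative_unique_within[OF _ V[OF D1] V[OF D2]])
      show "at 0 within {0..1} \<noteq> (bot :: real filter)"
        by (simp add: trivial_limit_within islimpt_Icc)
    qed
  qed
  have "D1 z = D2 z" using *[of 0] r l by (simp add: linear_neg)
  hence ball: "D1 y = D2 y" if "y \<in> cball 0 r" for y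
    using *[OF that] l by (simp add: linear_diff)
  show ?thesis
  proof
    fix v
    show "D1 v = D2 v"
    proof (cases "v = 0")
      case False
      have "(r / norm v) *\<^sub>R v \<in> cball 0 r" using False r by simp
      hence "(r / norm v) *\<^sub>R D1 v = (r / norm v) *\<^sub>R D2 v"
        using ball l by (metis linear_cmul)
      thus ?thesis using False r by simp
    qed (use l in \<open>simp add: linear_0\<close>)
  qed
qed

text \<open>The partial derivatives are defined by choosing some relative derivative; uniqueness makes them
  additive, which gives their continuity.\<close>

lemma C1_on_diff:
  fixes h1 h2 :: "real ^ 'n \<Rightarrow> real"
  assumes r: "0 < r" and h: "C1_on (cball 0 r) h1" "C1_on (cball 0 r) h2"
  shows "C1_on (cball 0 r) (\<lambda>z. h1 z - h2 z)"
proof -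
  have d: "h1 differentiable_on cball 0 r" "h2 differentiable_on cball 0 r"
    using h by (auto simp: C1_on_def)
  have d': "(\<lambda>z. h1 z - h2 z) differentiable_on cball 0 r"
    by (rule differentiable_on_diff[OF d])
  have eq: "partial_within (cball 0 r) (\<lambda>z. h1 z - h2 z) n z
      = partial_within (cball 0 r) h1 n z - partial_within (cball 0 r) h2 n z"
    if z: "z \<in> cball 0 r" for n z
  proof -
    have D: "(f has_derivative frechet_derivative f (at z within cball 0 r)) (at z within cball 0 r)"
      if "f differentiable_on cball 0 r" for f :: "real ^ 'n \<Rightarrow> real"
      using that z frechet_derivative_works unfolding differentiable_on_def by blast
    have "frechet_derivative (\<lambda>z. h1 z - h2 z) (at z within cball 0 r)
      = (\<lambda>v. frechet_derivative h1 (at z within cball 0 r) v - frechet_derivative h2 (at z within cball 0 r) v)"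
      by (rule has_derivative_within_cball_unique[OF r z D[OF d'] has_derivative_diff[OF D D]]) (rule d)+
    thus ?thesis by (simp add: partial_within_def)
  qed
  have "continuous_on (cball 0 r) (partial_within (cball 0 r) (\<lambda>z. h1 z - h2 z) n)" for n
  proof -
    have "continuous_on (cball 0 r) (\<lambda>z. partial_within (cball 0 r) h1 n z - partial_within (cball 0 r) h2 n z)"
      using h by (intro continuous_intros) (auto simp: C1_on_def)
    thus ?thesis by (rule continuous_on_cong[THEN iffD2, rotated 2]) (auto simp: eq)
  qed
  thus ?thesis using d' by (simp add: C1_on_def)
qed

lemma C_norm_upper:
  assumes "compact I" "continuous_on I h" "z \<in> I"
  shows "\<bar>h z\<bar> \<le> C_norm I h"
proof -
  have "compact ((\<lambda>z. \<bar>h z\<bar>) ` I)"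
    using assms by (intro compact_continuous_image continuous_intros)
  hence "bdd_above ((\<lambda>z. \<bar>h z\<bar>) ` I)" by (intro bounded_imp_bdd_above compact_imp_bounded)
  thus ?thesis unfolding C_norm_def using assms(3) by (intro cSUP_upper)
qed

lemma C_norm_nonneg:
  assumes "compact I" "continuous_on I h" "I \<noteq> {}"
  shows "0 \<le> C_norm I h"
  using C_norm_upper[OF assms(1,2)] assms(3) by (metis abs_ge_zero all_not_in_conv order_trans)

text \<open>The ball is convex, so the mean value inequality applies; the operator norm of the derivative is
  at most the sum of the absolute values of the partial derivatives.\<close>

lemma C1_on_Lipschitz:
  fixes h :: "real ^ 'n \<Rightarrow> real"
  assumes r: "0 < r" and h: "C1_on (cball 0 r) h"
  shows "0 \<le> C1_norm (cball 0 r) h"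
    and "\<And>z w. z \<in> cball 0 r \<Longrightarrow> w \<in> cball 0 r \<Longrightarrow> \<bar>h z - h w\<bar> \<le> C1_norm (cball 0 r) h * norm (z - w)"
proof -
  define I :: "(real ^ 'n) set" where "I = cball 0 r"
  have I: "compact I" "I \<noteq> {}" "convex I" using r by (auto simp: I_def)
  have d: "h differentiable_on I" and c: "\<And>n. continuous_on I (partial_within I h n)"
    using h by (auto simp: C1_on_def I_def)
  have ch: "continuous_on I h" using d by (rule differentiable_imp_continuous_on)
  define L where "L = (\<Sum>n\<in>UNIV. C_norm I (partial_within I h n))"
  have L: "0 \<le> L" unfolding L_def by (intro sum_nonneg C_norm_nonneg I c)
  have le: "L \<le> C1_norm I h" using C_norm_nonneg[OF I(1) ch I(2)] by (simp add: C1_norm_def L_def)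
  thus "0 \<le> C1_norm (cball 0 r) h" using L by (simp add: I_def)
  fix z w :: "real ^ 'n" assume zw: "z \<in> cball 0 r" "w \<in> cball 0 r"
  define D where "D x = frechet_derivative h (at x within I)" for x
  have D: "(h has_derivative D x) (at x within I)" if "x \<in> I" for x
    using that d frechet_derivative_works unfolding differentiable_on_def D_def by blast
  have "norm (h z - h w) \<le> L * norm (z - w)"
  proof (rule differentiable_bound[OF I(3) D])
    show "z \<in> I" "w \<in> I" using zw by (auto simp: I_def)
    fix x assume x: "x \<in> I"
    have lin: "linear (D x)" using D[OF x] by (rule has_derivative_linear)
    show "onorm (D x) \<le> L"
    proof (rule onorm_le)
      fix v :: "real ^ 'n"
      have "D x v = D x (\<Sum>n\<in>UNIV. (v $ n) *\<^sub>R axis n 1)"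
        using basis_expansion[of v] by (simp add: scalar_mult_eq_scaleR)
      also have "\<dots> = (\<Sum>n\<in>UNIV. (v $ n) * partial_within I h n x)"
        unfolding linear_sum[OF lin] linear_cmul[OF lin] by (simp add: partial_within_def D_def)
      also have "norm \<dots> \<le> (\<Sum>n\<in>UNIV. norm v * C_norm I (partial_within I h n))"
      proof (rule sum_norm_le)
        fix n
        show "norm ((v $ n) * partial_within I h n x) \<le> norm v * C_norm I (partial_within I h n)"
          unfolding norm_mult using C_norm_upper[OF I(1) c x, of n] Finite_Cartesian_Product.norm_nth_le[of v n]
          by (intro mult_mono) auto
      qed
      also have "\<dots> = L * norm v" by (simp add: L_def sum_distrib_left[symmetric] mult.commute)
      finally show "norm (D x v) \<le> L * norm v" .
    qed
  qed
  also have "\<dots> \<le> C1_norm I h * norm (z - w)" using le by (rule mult_right_mono) simp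
  finally show "\<bar>h z - h w\<bar> \<le> C1_norm (cball 0 r) h * norm (z - w)" by (simp add: I_def)
qed

text \<open>Vanishing at the origin turns the Lipschitz bound into \<open>\<bar>h (u x)\<bar> \<le> L \<parallel>u x\<parallel>\<close>, which is what makes the
  composition square-integrable on the whole line.\<close>

lemma C1_on_compose_L2:
  fixes h :: "real ^ 'n \<Rightarrow> real"
  assumes r: "0 < r" and h: "C1_on (cball 0 r) h" "h 0 = 0"
    and u: "u \<in> H1vec_space" "\<And>x. u x \<in> cball 0 r"
  shows "continuous_on UNIV (\<lambda>x. h (u x))" "(\<lambda>x. h (u x)) \<in> L2_space"
    "\<And>x. \<bar>h (u x)\<bar> \<le> C1_norm (cball 0 r) h * r"
    "L2_norm (\<lambda>x. h (u x)) \<le> C1_norm (cball 0 r) h * H1vec_norm u"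
proof -
  note L = C1_on_Lipschitz[OF r h(1)]
  note D = H1vec_L2[OF u(1)]
  have "continuous_on (cball 0 r) h"
    using h(1) differentiable_imp_continuous_on by (auto simp: C1_on_def)
  thus c: "continuous_on UNIV (\<lambda>x. h (u x))"
    using u(2) by (intro continuous_on_compose2[OF _ D(1)]) auto
  have pt: "\<bar>h (u x)\<bar> \<le> C1_norm (cball 0 r) h * norm (u x)" for x
    using L(2)[OF u(2), of 0 x] r h(2) by simp
  have pt': "\<bar>h (u x)\<bar> \<le> C1_norm (cball 0 r) h * \<bar>norm (u x)\<bar>" for x
    using pt by simp
  show "\<bar>h (u x)\<bar> \<le> C1_norm (cball 0 r) h * r" for x
    using pt[of x] mult_left_mono[OF _ L(1), of "norm (u x)" r] u(2)[of x] by simp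
  note dom = L2_dominated[OF D(2) continuous_lebesgue_measurable[OF c] pt' L(1)]
  show "(\<lambda>x. h (u x)) \<in> L2_space" by (rule dom)
  show "L2_norm (\<lambda>x. h (u x)) \<le> C1_norm (cball 0 r) h * H1vec_norm u"
    using dom(2) mult_left_mono[OF D(3) L(1)] by linarith
qed

lemma C1_on_compose_diff_L2:
  fixes h :: "real ^ 'n \<Rightarrow> real"
  assumes r: "0 < r" and h: "C1_on (cball 0 r) h"
    and u: "u \<in> H1vec_space" "\<And>x. u x \<in> cball 0 r"
    and v: "v \<in> H1vec_space" "\<And>x. v x \<in> cball 0 r"
    and w: "(\<lambda>x. u x - v x) \<in> H1vec_space"
  shows "(\<lambda>x. h (u x) - h (v x)) \<in> L2_space"
    "L2_norm (\<lambda>x. h (u x) - h (v x)) \<le> C1_norm (cball 0 r) h * H1vec_norm (\<lambda>x. u x - v x)"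
proof -
  note L = C1_on_Lipschitz[OF r h]
  note D = H1vec_L2[OF w]
  have ch: "continuous_on (cball 0 r) h"
    using h differentiable_imp_continuous_on by (auto simp: C1_on_def)
  have "continuous_on UNIV (\<lambda>x. h (u x))" "continuous_on UNIV (\<lambda>x. h (v x))"
    using u(2) v(2) H1vec_L2(1)[OF u(1)] H1vec_L2(1)[OF v(1)]
    by (auto intro!: continuous_on_compose2[OF ch])
  hence c: "continuous_on UNIV (\<lambda>x. h (u x) - h (v x))" by (intro continuous_intros)
  have pt: "\<bar>h (u x) - h (v x)\<bar> \<le> C1_norm (cball 0 r) h * \<bar>norm (u x - v x)\<bar>" for x
    using L(2)[OF u(2) v(2), of x x] by simp
  note dom = L2_dominated[OF D(2) continuous_lebesgue_measurable[OF c] pt L(1)]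
  show "(\<lambda>x. h (u x) - h (v x)) \<in> L2_space" by (rule dom)
  show "L2_norm (\<lambda>x. h (u x) - h (v x)) \<le> C1_norm (cball 0 r) h * H1vec_norm (\<lambda>x. u x - v x)"
    using dom(2) mult_left_mono[OF D(3) L(1)] by linarith
qed

section \<open>The perturbation estimate\<close>

text \<open>The difference of products is split as \<open>T (f1 - f2) C1 + T f2 (C1 - C2)\<close>.\<close>

lemma H1_norm_product_difference:
  assumes ca: "H1_algebra_constant ca" and T: "bounded_linear_H1 T"
    and f: "f1 \<in> H1_space" "f2 \<in> H1_space" and c: "C1 \<in> H1_space" "C2 \<in> H1_space"
  shows "H1_norm (\<lambda>x. T f1 x * C1 x - T f2 x * C2 x)
     \<le> ca * onorm_H1 T * (H1_norm (\<lambda>x. f1 x - f2 x) * H1_norm C1 + H1_norm f2 * H1_norm (\<lambda>x. C1 x - C2 x))"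
proof -
  have alg: "(\<lambda>x. p x * q x) \<in> H1_space" "H1_norm (\<lambda>x. p x * q x) \<le> ca * H1_norm p * H1_norm q"
    if "p \<in> H1_space" "q \<in> H1_space" for p q
    using ca that unfolding H1_algebra_constant_def by blast+
  have ca0: "0 \<le> ca" using ca by (simp add: H1_algebra_constant_def)
  have Tm: "T p \<in> H1_space" if "p \<in> H1_space" for p
    using T that by (simp add: bounded_linear_H1_def)
  have df: "(\<lambda>x. f1 x - f2 x) \<in> H1_space" using H1_lincomb(1)[OF f, of 1 "-1"] by simp
  have dC: "(\<lambda>x. C1 x - C2 x) \<in> H1_space" using H1_lincomb(1)[OF c, of 1 "-1"] by simp
  have prod: "H1_norm (\<lambda>x. T p x * q x) \<le> ca * onorm_H1 T * (H1_norm p * H1_norm q)"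
    if p: "p \<in> H1_space" and q: "q \<in> H1_space" for p q
  proof -
    have "H1_norm (\<lambda>x. T p x * q x) \<le> ca * H1_norm (T p) * H1_norm q"
      by (rule alg(2)[OF Tm[OF p] q])
    also have "\<dots> \<le> ca * (onorm_H1 T * H1_norm p) * H1_norm q"
      by (intro mult_right_mono mult_left_mono onorm_H1_bound T p ca0 H1_norm_nonneg)
    finally show ?thesis by (simp add: mult_ac)
  qed
  have eq: "(\<lambda>x. T f1 x * C1 x - T f2 x * C2 x)
      = (\<lambda>x. 1 * (T (\<lambda>x. f1 x - f2 x) x * C1 x) + 1 * (T f2 x * (C1 x - C2 x)))"
    unfolding bounded_linear_H1_diff[OF T f] by (auto simp: algebra_simps)
  have "H1_norm (\<lambda>x. T f1 x * C1 x - T f2 x * C2 x)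
      \<le> \<bar>1\<bar> * H1_norm (\<lambda>x. T (\<lambda>x. f1 x - f2 x) x * C1 x) + \<bar>1\<bar> * H1_norm (\<lambda>x. T f2 x * (C1 x - C2 x))"
    unfolding eq by (rule H1_lincomb(2)[OF alg(1)[OF Tm[OF df] c(1)] alg(1)[OF Tm[OF f(2)] dC]])
  also have "\<dots> \<le> ca * onorm_H1 T * (H1_norm (\<lambda>x. f1 x - f2 x) * H1_norm C1)
      + ca * onorm_H1 T * (H1_norm f2 * H1_norm (\<lambda>x. C1 x - C2 x))"
    using prod[OF df c(1)] prod[OF f(2) dC] by simp
  finally show ?thesis by (simp add: distrib_left)
qed

theorem theorem1p4:
  fixes K :: "'n :: finite \<Rightarrow> real \<Rightarrow> real"
    and T :: "'n \<Rightarrow> (real \<Rightarrow> real) \<Rightarrow> (real \<Rightarrow> real)"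
    and u0 up1 up2 u1 u2 :: "real \<Rightarrow> real ^ 'n"
    and g1 g2 :: "real ^ 'n \<Rightarrow> real ^ 'n"
    and ca \<rho> M \<sigma> :: real
  assumes "0 < \<rho>" and "\<rho> \<le> 1" and "0 < M"
    and "H1_algebra_constant ca"
    and "\<And>m. K m \<in> W11_space" and "\<And>m. \<not> (AE x in lebesgue. K m x = 0)"
    and "u0 \<in> H1vec_space" and "\<exists>m x. u0 x $ m \<noteq> 0"
    and "\<And>m. bounded_linear_H1 (T m)" and "\<And>m. 0 < onorm_H1 (T m)"
    and "\<And>m. g1 0 $ m = 0" and "\<And>m. g2 0 $ m = 0"
    and "g1 \<in> C1vec_ball (range_ball u0) M" and "g2 \<in> C1vec_ball (range_ball u0) M"
    and "\<exists>z\<in>range_ball u0. g1 z \<noteq> 0" and "\<exists>z\<in>range_ball u0. g2 z \<noteq> 0"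
    and "ca * M * (H1vec_norm u0 + 1)\<^sup>2 * Q_const T K \<le> \<rho> / 2"
    and "up1 \<in> H1vec_ball \<rho>" and "tau T K u0 g1 up1 = up1"
    and "up2 \<in> H1vec_ball \<rho>" and "tau T K u0 g2 up2 = up2"
    and "u1 = (\<lambda>x. u0 x + up1 x)" and "u2 = (\<lambda>x. u0 x + up2 x)"
    and "\<sigma> = 2 * ca * Q_const T K * M * (H1vec_norm u0 + 1)"
  shows "H1vec_norm (\<lambda>x. u1 x - u2 x) \<le>
           \<sigma> / (2 * M * (1 - \<sigma>)) * (H1vec_norm u0 + 1)
             * C1vec_norm (range_ball u0) (\<lambda>z. g1 z - g2 z)"
proof -
  note ca = assms(4) and K = assms(5) and u0 = assms(7) and T = assms(9) and T0 = assms(10)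
  define U where "U = H1vec_norm u0"
  define R where "R = U + 1"
  define r where "r = 1 / sqrt 2 * R"
  define Q where "Q = Q_const T K"
  define I :: "(real ^ 'n) set" where "I = cball 0 r"
  have I: "range_ball u0 = I" by (simp add: range_ball_def I_def r_def R_def U_def)
  \<comment> \<open>Strictness is needed at the end for the contraction factor, in case the bound on it is attained.\<close>
  have U: "0 < U"
  proof -
    obtain m x where "u0 x $ m \<noteq> 0" using assms(8) by blast
    hence "0 < norm (u0 x)" by auto
    also have "\<dots> \<le> 1 / sqrt 2 * U" unfolding U_def by (rule H1vec_Sobolev[OF u0])
    finally show ?thesis by (simp add: zero_less_divide_iff)
  qed
  have R: "1 < R" using U by (simp add: R_def)
  have r: "0 < r" using R by (simp add: r_def)

  \<comment> \<open>The condition on the radius of the fixed point ball enters here, to keep the solutions inside the range ball.\<close>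
  have sol: "u \<in> H1vec_space \<and> H1vec_norm u \<le> R \<and> (\<forall>x. u x \<in> cball 0 r)"
    if "up \<in> H1vec_ball \<rho>" "u = (\<lambda>x. u0 x + up x)" for u up
  proof -
    have up: "up \<in> H1vec_space" "H1vec_norm up \<le> 1" using that assms(2) by (auto simp: H1vec_ball_def)
    have u: "u \<in> H1vec_space" and le: "H1vec_norm u \<le> R"
      using H1vec_add[OF u0 up(1)] up(2) that(2) by (auto simp: R_def U_def)
    have "norm (u x) \<le> r" for x
      using H1vec_Sobolev[OF u, of x] le by (simp add: r_def divide_right_mono order_trans)
    thus ?thesis using u le by simp
  qed
  note u1 = sol[OF assms(18,22)] and u2 = sol[OF assms(20,23)]
  have u1m: "(\<lambda>x. u1 x $ m) \<in> H1_space" and u2m: "(\<lambda>x. u2 x $ m) \<in> H1_space" for m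
    using u1 u2 by (auto simp: H1vec_space_def)

  define w where "w x = u1 x - u2 x" for x
  have w: "w \<in> H1vec_space"
    using H1_lincomb(1)[OF u1m u2m, of 1 _ "-1"] by (simp add: H1vec_space_def w_def)
  define W where "W = H1vec_norm w"
  define D where "D = C1vec_norm I (\<lambda>z. g1 z - g2 z)"

  have g1: "C1_on I (\<lambda>z. g1 z $ m)" and g2: "C1_on I (\<lambda>z. g2 z $ m)"
    and gM: "C1vec_norm I g1 \<le> M" for m
    using assms(13,14) by (auto simp: C1vec_ball_def I)
  have g12: "C1_on I (\<lambda>z. (g1 z - g2 z) $ m)" for m
    using C1_on_diff[OF r g1[unfolded I_def] g2[unfolded I_def], of m] by (simp add: I_def)
  have comp_le: "C1_norm I (\<lambda>z. g z $ m) \<le> C1vec_norm I g"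
    if "\<And>m. C1_on I (\<lambda>z. g z $ m)" for g :: "real ^ 'n \<Rightarrow> real ^ 'n" and m
    unfolding C1vec_norm_def
    using C1_on_Lipschitz(1)[OF r that[unfolded I_def]] by (intro member_le_sum) (auto simp: I_def)

  have component: "H1_norm (\<lambda>x. w x $ m)
      \<le> onorm_H1 (T m) * W11_norm (K m) * (ca * (2 * M * R * W + R\<^sup>2 * D))" for m
  proof -
    define G1 where "G1 y = g1 (u1 y) $ m" for y
    define G2 where "G2 y = g2 (u2 y) $ m" for y
    define H where "H y = g1 (u2 y) $ m" for y
    have u1I: "\<And>x. u1 x \<in> cball 0 r" and u2I: "\<And>x. u2 x \<in> cball 0 r" using u1 u2 by auto
    note c1 = C1_on_compose_L2[OF r g1[of m, unfolded I_def] assms(11) conjunct1[OF u1] u1I, folded I_def G1_def]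
    note c2 = C1_on_compose_L2[OF r g2[of m, unfolded I_def] assms(12) conjunct1[OF u2] u2I, folded I_def G2_def]
    have z12: "(g1 0 - g2 0) $ m = 0" using assms(11,12) by simp
    note cd = C1_on_compose_L2[OF r g12[of m, unfolded I_def] z12 conjunct1[OF u2] u2I, folded I_def]
    note ch = C1_on_compose_diff_L2[OF r g1[of m, unfolded I_def] conjunct1[OF u1] u1I conjunct1[OF u2] u2I
        w[unfolded w_def[abs_def]], folded I_def]
    define \<kappa> where "\<kappa> = W11_norm (K m)"
    have \<kappa>: "0 \<le> \<kappa>" by (simp add: \<kappa>_def W11_norm_def L1_norm_def)
    have D0: "C1_norm I (\<lambda>z. (g1 z - g2 z) $ m) \<le> D" unfolding D_def by (rule comp_le[OF g12])
    have M0: "C1_norm I (\<lambda>z. g1 z $ m) \<le> M" using comp_le[of g1 m, OF g1] gM by simp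
    have D': "0 \<le> D"
      using D0 C1_on_Lipschitz(1)[OF r g12[of m, unfolded I_def]] by (simp add: I_def)
    have n1: "L2_norm G1 \<le> M * R"
    proof -
      have "C1_norm I (\<lambda>z. g1 z $ m) * H1vec_norm u1 \<le> M * R"
        using M0 u1 assms(3) by (intro mult_mono) auto
      thus ?thesis using c1(4) by linarith
    qed
    have n12: "L2_norm (\<lambda>y. G1 y - G2 y) \<le> M * W + D * R"
    proof -
      have eq: "(\<lambda>y. G1 y - G2 y)
          = (\<lambda>y. 1 * (g1 (u1 y) $ m - g1 (u2 y) $ m) + 1 * ((g1 (u2 y) - g2 (u2 y)) $ m))"
        by (simp add: G1_def G2_def)
      have "L2_norm (\<lambda>y. G1 y - G2 y) \<le> \<bar>1\<bar> * L2_norm (\<lambda>y. g1 (u1 y) $ m - g1 (u2 y) $ m)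
           + \<bar>1\<bar> * L2_norm (\<lambda>y. (g1 (u2 y) - g2 (u2 y)) $ m)"
        unfolding eq by (rule L2_norm_lincomb[OF ch(1) cd(2)])
      also have "\<dots> \<le> C1_norm I (\<lambda>z. g1 z $ m) * W + C1_norm I (\<lambda>z. (g1 z - g2 z) $ m) * H1vec_norm u2"
        using ch(2) cd(4) by (simp add: W_def w_def[abs_def])
      also have "\<dots> \<le> M * W + D * R"
        using M0 D0 D' u2 by (intro add_mono mult_mono mult_right_mono) (auto simp: W_def)
      finally show ?thesis .
    qed
    have Gd: "(\<lambda>y. G1 y - G2 y) \<in> L2_space"
      using L2_lincomb[OF c1(2) c2(2), of 1 "-1"] by simp
    have Gc: "continuous_on UNIV (\<lambda>y. G1 y - G2 y)" using c1(1) c2(1) by (intro continuous_intros)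
    have Gb: "\<bar>G1 y - G2 y\<bar> \<le> C1_norm I (\<lambda>z. g1 z $ m) * r + C1_norm I (\<lambda>z. g2 z $ m) * r" for y
      using c1(3)[of y] c2(3)[of y] by linarith
    note H1 = conv_H1[OF K[of m] c1(1,3,2)] and H2 = conv_H1[OF K[of m] c2(1,3,2)]
    note Hd = conv_H1[OF K[of m] Gc Gb Gd]
    have cd_eq: "(\<lambda>x. conv (K m) G1 x - conv (K m) G2 x) = conv (K m) (\<lambda>y. G1 y - G2 y)"
      using conv_diff[OF W11_spaceD(1)[OF K] c1(1,3) c2(1,3)] by auto
    have "w x $ m = T m (\<lambda>y. u1 y $ m) x * conv (K m) G1 x - T m (\<lambda>y. u2 y $ m) x * conv (K m) G2 x" for x
      using fixed_point_tau_solves_system[OF assms(19,22), of x m]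
        fixed_point_tau_solves_system[OF assms(21,23), of x m]
      by (simp add: w_def conv_def G1_def G2_def)
    hence "H1_norm (\<lambda>x. w x $ m)
       \<le> ca * onorm_H1 (T m) * (H1_norm (\<lambda>x. u1 x $ m - u2 x $ m) * H1_norm (conv (K m) G1)
            + H1_norm (\<lambda>x. u2 x $ m) * H1_norm (conv (K m) (\<lambda>y. G1 y - G2 y)))"
      using H1_norm_product_difference[OF ca T u1m u2m H1(1) H2(1), of m m m] by (simp add: cd_eq)
    also have "\<dots> \<le> ca * onorm_H1 (T m) * (W * (\<kappa> * (M * R)) + R * (\<kappa> * (M * W + D * R)))"
    proof (intro mult_left_mono add_mono)
      show "H1_norm (\<lambda>x. u1 x $ m - u2 x $ m) * H1_norm (conv (K m) G1) \<le> W * (\<kappa> * (M * R))"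
      proof (rule mult_mono)
        show "H1_norm (\<lambda>x. u1 x $ m - u2 x $ m) \<le> W"
          using H1_norm_component_le[of w m] by (simp add: W_def w_def)
        show "H1_norm (conv (K m) G1) \<le> \<kappa> * (M * R)"
          using H1(2) mult_left_mono[OF n1 \<kappa>] by (simp add: \<kappa>_def)
      qed (simp_all add: W_def)
      show "H1_norm (\<lambda>x. u2 x $ m) * H1_norm (conv (K m) (\<lambda>y. G1 y - G2 y)) \<le> R * (\<kappa> * (M * W + D * R))"
      proof (rule mult_mono)
        show "H1_norm (\<lambda>x. u2 x $ m) \<le> R" using H1_norm_component_le[of u2 m] u2 by simp
        show "H1_norm (conv (K m) (\<lambda>y. G1 y - G2 y)) \<le> \<kappa> * (M * W + D * R)"
          using Hd(2) mult_left_mono[OF n12 \<kappa>] by (simp add: \<kappa>_def)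
      qed (use R in simp_all)
      show "0 \<le> ca * onorm_H1 (T m)"
        using ca T0[of m] by (simp add: H1_algebra_constant_def)
    qed
    also have "\<dots> = onorm_H1 (T m) * W11_norm (K m) * (ca * (2 * M * R * W + R\<^sup>2 * D))"
      by (simp add: \<kappa>_def power2_eq_square algebra_simps)
    finally show ?thesis .
  qed

  have ca0: "0 < ca" using ca by (simp add: H1_algebra_constant_def)
  have W0: "0 \<le> W" by (simp add: W_def)
  have D0: "0 \<le> D"
    unfolding D_def C1vec_norm_def
    using C1_on_Lipschitz(1)[OF r g12[unfolded I_def]] by (intro sum_nonneg) (auto simp: I_def)
  have c0: "0 \<le> ca * (2 * M * R * W + R\<^sup>2 * D)"
    using ca0 assms(3) R W0 D0 by simp
  have "W = L2_set (\<lambda>m. H1_norm (\<lambda>x. w x $ m)) UNIV"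
    unfolding W_def by (rule H1vec_norm_eq_L2_set)
  also have "\<dots> \<le> L2_set (\<lambda>m. onorm_H1 (T m) * W11_norm (K m) * (ca * (2 * M * R * W + R\<^sup>2 * D))) UNIV"
    by (rule L2_set_mono[OF component H1_norm_nonneg])
  also have "\<dots> = Q * (ca * (2 * M * R * W + R\<^sup>2 * D))"
    by (simp add: L2_set_left_distrib[OF c0, symmetric] Q_def Q_const_def L2_set_def power_mult_distrib)
  also have "\<dots> = \<sigma> * W + \<sigma> / (2 * M) * R * D"
    using assms(3,24) by (simp add: Q_def R_def U_def power2_eq_square field_simps)
  finally have main: "W * (1 - \<sigma>) \<le> \<sigma> / (2 * M) * R * D" by (simp add: algebra_simps)
  \<comment> \<open>The smallness hypothesis controls the factor times the radius, which is larger than one.\<close>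
  have "\<sigma> < 1"
  proof (rule ccontr)
    assume "\<not> \<sigma> < 1"
    hence "1 * R \<le> \<sigma> * R" using R by (intro mult_right_mono) auto
    moreover have "\<sigma> * R \<le> \<rho>"
    proof -
      have "\<sigma> * R = 2 * (ca * M * R\<^sup>2 * Q)"
        by (simp add: assms(24) R_def U_def Q_def power2_eq_square algebra_simps)
      moreover have "ca * M * R\<^sup>2 * Q \<le> \<rho> / 2"
        using assms(17) by (simp add: R_def U_def Q_def)
      ultimately show ?thesis by linarith
    qed
    ultimately show False using R assms(2) by linarith
  qed
  hence "0 < 1 - \<sigma>" by simp
  from pos_le_divide_eq[OF this, THEN iffD2, OF main]
  have "W \<le> \<sigma> / (2 * M) * R * D / (1 - \<sigma>)" .
  also have "\<dots> = \<sigma> / (2 * M * (1 - \<sigma>)) * R * D" by simp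
  finally show ?thesis by (simp add: W_def w_def[abs_def] R_def U_def D_def I)
qed

end
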